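(* Let $m\in\mathbb{N}$ be even. There exists a constant $C_0>0$ depending only on $m$ such that for every $C\ge C_0$ and every $\delta>0$ there is $\varepsilon\in(0,1)$, depending only on $m$, $\delta$ and $C$, with the following property. For $M\in\mathbb{N}$ (large enough that $\tau$ below is at most $1$), let $g\in\mathbb{C}^M$ be a random Steinhaus window, i.e. $g(j)=\frac{1}{\sqrt{M}}e^{2\pi i y_j}$ for $j\in\mathbb{Z}_M$ with $y_j$ independent and uniformly distributed on $[0,1)$, and let $\Lambda\subset\mathbb{Z}_M\times\mathbb{Z}_M$ be a random set, independent of $g$, such that the events $\{(k,\ell)\in\Lambda\}$, $(k,\ell)\in\mathbb{Z}_M\times\mathbb{Z}_M$, are independent and each has probability $\tau=\frac{C\log M}{M^{\frac{m-1}{m}}}$. Then, with high probability with respect to the choice of $\Lambda$ (that is, with probability tending to $1$ as $M\to\infty$), the set $\Lambda$ is such that $$\mathbb{P}_g\left\{\frac{|\Lambda|}{M}(1-\delta)\le\sigma_{\min}^2(\Phi_\Lambda^* )\le\sigma_{\max}^2(\Phi_\Lambda^* )\le\frac{|\Lambda|}{M}(1+\delta)\right\}\ge 1-\varepsilon,$$ where $\mathbb{P}_g$ denotes probability with respect to $g$ (with $\Lambda$ fixed) and $\Phi_\Lambda$ is the synthesis matrix of the Gabor system $(g,\Lambda)$.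
   Context: Vectors $x\in\mathbb{C}^M$ are viewed as functions $x:\mathbb{Z}_M\to\mathbb{C}$, with index arithmetic modulo $M$. For $(k,\ell)\in\mathbb{Z}_M\times\mathbb{Z}_M$, the time-frequency shift operator $\pi(k,\ell)$ on $\mathbb{C}^M$ is $(\pi(k,\ell)x)(j)=e^{2\pi i\ell j/M}x(j-k)$. The Gabor system generated by the window $g$ and the set $\Lambda\subset\mathbb{Z}_M\times\mathbb{Z}_M$ is the family $(g,\Lambda)=\{\pi(k,\ell)g\}_{(k,\ell)\in\Lambda}$ (indexed by $\Lambda$). Its synthesis matrix $\Phi_\Lambda\in\mathbb{C}^{M\times|\Lambda|}$ has the vectors $\pi(\lambda)g$, $\lambda\in\Lambda$, as columns; the analysis matrix is the adjoint $\Phi_\Lambda^*$. Here $\sigma_{\min}^2(\Phi_\Lambda^* )$ and $\sigma_{\max}^2(\Phi_\Lambda^* )$ are the minimum and maximum of $\sum_{\lambda\in\Lambda}|\langle x,\pi(\lambda)g\rangle|^2$ over $x\in\mathbb{C}^M$ with $\|x\|_2=1$ (the smallest and largest eigenvalues of $\Phi_\Lambda\Phi_\Lambda^*$). *)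

theory Defs
  imports
    "HOL-Probability.Probability"
    "Jordan_Normal_Form.Schur_Decomposition"
begin

(* Vectors in C^M are elements of carrier_vec M; their index set {0..<M} represents Z_M.
   Both HOL-Analysis and Jordan_Normal_Form define vec and mat, and both use the
   infix dollar sign, so the Jordan_Normal_Form constants are written out. *)

definition l2_norm_vec :: "complex Matrix.vec \<Rightarrow> real" where
  "l2_norm_vec v = sqrt (\<Sum>i<dim_vec v. (cmod (vec_index v i))\<^sup>2)"

(* (pi(k,l) x)(j) = exp(2 pi i l j / M) x(j - k); the reduction of j - k modulo M is done
   on the integers because subtraction on nat truncates. *)
definition tf_shift :: "nat \<Rightarrow> nat \<times> nat \<Rightarrow> complex Matrix.vec \<Rightarrow> complex Matrix.vec" where
  "tf_shift M = (\<lambda>(k, l) x. Matrix.vec M (\<lambda>j.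
     cis (2 * pi * real l * real j / real M) * vec_index x (nat ((int j - int k) mod int M))))"

(* The family (pi(k,l) g), indexed by the (k,l) in \<Lambda>. The index set is a finite set of
   pairs, which is listed lexicographically here; another order only permutes the columns of
   the synthesis matrix. Equal vectors for different indices are kept apart. *)
definition gabor_system ::
    "nat \<Rightarrow> complex Matrix.vec \<Rightarrow> (nat \<times> nat) set \<Rightarrow> complex Matrix.vec list" where
  "gabor_system M g \<Lambda> =
     map (\<lambda>p. tf_shift M p g) (filter (\<lambda>p. p \<in> \<Lambda>) (List.product [0..<M] [0..<M]))"

definition synthesis_mat ::
    "nat \<Rightarrow> complex Matrix.vec \<Rightarrow> (nat \<times> nat) set \<Rightarrow> complex Matrix.mat" where
  "synthesis_mat M g \<Lambda> = mat_of_cols M (gabor_system M g \<Lambda>)"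

definition analysis_mat ::
    "nat \<Rightarrow> complex Matrix.vec \<Rightarrow> (nat \<times> nat) set \<Rightarrow> complex Matrix.mat" where
  "analysis_mat M g \<Lambda> = mat_adjoint (synthesis_mat M g \<Lambda>)"

(* Minimum and maximum of the squared norm of A x over unit vectors x. By compactness of the
   sphere, Inf and Sup are attained whenever A has at least one column. *)
definition sigma_min_sq :: "complex Matrix.mat \<Rightarrow> real" where
  "sigma_min_sq A =
     (INF x \<in> {x \<in> carrier_vec (dim_col A). l2_norm_vec x = 1}. (l2_norm_vec (A *\<^sub>v x))\<^sup>2)"

definition sigma_max_sq :: "complex Matrix.mat \<Rightarrow> real" where
  "sigma_max_sq A =
     (SUP x \<in> {x \<in> carrier_vec (dim_col A). l2_norm_vec x = 1}. (l2_norm_vec (A *\<^sub>v x))\<^sup>2)"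

(* For the analysis matrix the squared norm is the sum of the squared frame coefficients. *)
lemma l2_norm_analysis_mat:
  assumes x: "x \<in> carrier_vec M" and \<Lambda>: "\<Lambda> \<subseteq> {..<M} \<times> {..<M}"
  shows "(l2_norm_vec (analysis_mat M g \<Lambda> *\<^sub>v x))\<^sup>2 = (\<Sum>p\<in>\<Lambda>. (cmod (x \<bullet>c tf_shift M p g))\<^sup>2)"
proof -
  define ps where "ps = filter (\<lambda>p. p \<in> \<Lambda>) (List.product [0..<M] [0..<M])"
  have set_ps: "set ps = \<Lambda>" and dist: "distinct ps"
    using \<Lambda> by (auto simp: ps_def distinct_product)
  have car: "tf_shift M p g \<in> carrier_vec M" for p
    by (auto simp: tf_shift_def split: prod.splits)
  have S: "synthesis_mat M g \<Lambda> = mat_of_cols M (map (\<lambda>p. tf_shift M p g) ps)"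
    by (simp add: synthesis_mat_def gabor_system_def ps_def)
  have cols: "cols (synthesis_mat M g \<Lambda>) = map (\<lambda>p. tf_shift M p g) ps"
    unfolding S by (rule cols_mat_of_cols) (use car in auto)
  have A: "analysis_mat M g \<Lambda> = mat_of_rows M (map (\<lambda>p. conjugate (tf_shift M p g)) ps)"
    unfolding analysis_mat_def mat_adjoint_def cols by (simp add: S o_def)
  have idx: "vec_index (analysis_mat M g \<Lambda> *\<^sub>v x) i = x \<bullet>c tf_shift M (ps ! i) g"
    if "i < length ps" for i
    using that car x unfolding A
    by (simp add: comm_scalar_prod[of _ M])
  have dim: "dim_vec (analysis_mat M g \<Lambda> *\<^sub>v x) = length ps"
    by (simp add: A)
  have "(l2_norm_vec (analysis_mat M g \<Lambda> *\<^sub>v x))\<^sup>2 =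
      (\<Sum>i<length ps. (cmod (x \<bullet>c tf_shift M (ps ! i) g))\<^sup>2)"
    by (simp add: l2_norm_vec_def sum_nonneg dim idx del: index_mult_mat_vec dim_mult_mat_vec)
  also have "\<dots> = (\<Sum>p\<leftarrow>ps. (cmod (x \<bullet>c tf_shift M p g))\<^sup>2)"
    by (simp add: sum_list_sum_nth atLeast0LessThan)
  also have "\<dots> = (\<Sum>p\<in>\<Lambda>. (cmod (x \<bullet>c tf_shift M p g))\<^sup>2)"
    using dist set_ps by (simp add: sum_list_distinct_conv_sum_set)
  finally show ?thesis .
qed

(* Joint law of the phases y_0, ..., y_(M-1): independent and uniform on [0,1). *)
definition phase_measure :: "nat \<Rightarrow> (nat \<Rightarrow> real) measure" where
  "phase_measure M = (\<Pi>\<^sub>M j\<in>{..<M}. uniform_measure lborel {0..<1})"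

definition steinhaus_window :: "nat \<Rightarrow> (nat \<Rightarrow> real) \<Rightarrow> complex Matrix.vec" where
  "steinhaus_window M y =
     Matrix.vec M (\<lambda>j. complex_of_real (1 / sqrt (real M)) * cis (2 * pi * y j))"

(* Law of the random subset of Z_M x Z_M containing each pair independently with probability
   t. bernoulli_pmf truncates its parameter to [0,1]. *)
definition random_index_set :: "nat \<Rightarrow> real \<Rightarrow> (nat \<times> nat) set pmf" where
  "random_index_set M t =
     map_pmf (\<lambda>b. {p. b p}) (Pi_pmf ({..<M} \<times> {..<M}) False (\<lambda>_. bernoulli_pmf t))"

definition tau :: "nat \<Rightarrow> real \<Rightarrow> nat \<Rightarrow> real" where
  "tau m C M = C * ln (real M) / real M powr ((real m - 1) / real m)"

(* Probability with respect to the window, for fixed \<Lambda>, of the two-sided bound. As \<Lambda> and the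
   window are independent, the law of the window does not change when \<Lambda> is fixed. *)
definition prob_frame_bounds :: "nat \<Rightarrow> real \<Rightarrow> (nat \<times> nat) set \<Rightarrow> real" where
  "prob_frame_bounds M \<delta> \<Lambda> =
     measure (phase_measure M) {y \<in> space (phase_measure M).
       (let A = analysis_mat M (steinhaus_window M y) \<Lambda> in
          real (card \<Lambda>) / real M * (1 - \<delta>) \<le> sigma_min_sq A \<and>
          sigma_min_sq A \<le> sigma_max_sq A \<and>
          sigma_max_sq A \<le> real (card \<Lambda>) / real M * (1 + \<delta>))}"

end

theory Submission
  imports Defs "HOL-Real_Asymp.Real_Asymp"
begin

text \<open>
  For every fixed window with entries of modulus \<open>1 / sqrt M\<close> the full Gabor system is a tight frame
  of \<open>M\<^sup>2\<close> unit vectors with bound \<open>M\<close>. So it suffices to bound, for each fixed window, the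
  operator norm of the random sum \<open>H = \<Sum>\<^sub>l \<xi>\<^sub>l u\<^sub>l u\<^sub>l\<^sup>*\<close> with the centred Bernoulli weights
  \<open>\<xi>\<^sub>l = of_bool (l \<in> \<Lambda>) - t\<close>; Fubini and Markov's inequality then give the statement for
  most \<open>\<Lambda>\<close>.

  The norm is controlled by the expected trace of \<open>H\<^sup>2\<^sup>s\<close>. Expanding one factor, resolving the
  dependence of \<open>H\<close> on \<open>\<xi>\<^sub>l\<close> and using log-convexity of the moments \<open>\<langle>u\<^sub>l, H\<^sup>q u\<^sub>l\<rangle>\<close> yields a recursion
  that gives \<open>E tr H\<^sup>2\<^sup>s \<le> K\<^sub>s M (t M)\<^sup>s\<close>. With \<open>s = m\<close> one has \<open>(t M)\<^sup>m = (C ln M)\<^sup>m M\<close>, and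
  Markov's inequality bounds the failure probability by a multiple of \<open>(ln M)\<close> to the power \<open>-m\<close>.
\<close>

section \<open>Moments of weighted sums of rank-one operators\<close>

definition ip :: "'n set \<Rightarrow> ('n \<Rightarrow> complex) \<Rightarrow> ('n \<Rightarrow> complex) \<Rightarrow> complex" where
  "ip N x y = (\<Sum>i\<in>N. x i * cnj (y i))"

abbreviation l2 :: "'n set \<Rightarrow> ('n \<Rightarrow> complex) \<Rightarrow> real" where
  "l2 N x \<equiv> L2_set (\<lambda>i. cmod (x i)) N"

text \<open>The operator \<open>H\<close> of the overview as a map on functions: its powers are
  iterates \<open>^^\<close>, and changing one weight is a function update of
  \<open>\<xi>\<close>.\<close>

definition rank_one_sum ::
    "'n set \<Rightarrow> 'l set \<Rightarrow> ('l \<Rightarrow> 'n \<Rightarrow> complex) \<Rightarrow> ('l \<Rightarrow> real) \<Rightarrow> ('n \<Rightarrow> complex) \<Rightarrow> 'n \<Rightarrow> complex" where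
  "rank_one_sum N A u \<xi> x = (\<lambda>j. \<Sum>l\<in>A. of_real (\<xi> l) * ip N x (u l) * u l j)"

lemma cnj_ip: "cnj (ip N x y) = ip N y x"
  by (simp add: ip_def mult.commute)

lemma norm_ip_square: "(of_real (cmod (ip N x y)))\<^sup>2 = ip N x y * ip N y x"
  by (metis cnj_ip complex_norm_square of_real_power)

lemma ip_self: "ip N x x = of_real ((l2 N x)\<^sup>2)"
  by (simp add: ip_def L2_set_def sum_nonneg flip: complex_norm_square)

lemma ip_add_left: "ip N (\<lambda>i. x i + y i) z = ip N x z + ip N y z"
  by (simp add: ip_def sum.distrib distrib_right)

lemma ip_scale_left: "ip N (\<lambda>i. c * x i) z = c * ip N x z"
  by (simp add: ip_def sum_distrib_left mult.assoc)

lemma ip_sum_left: "ip N (\<lambda>i. \<Sum>k\<in>K. x k i) z = (\<Sum>k\<in>K. ip N (x k) z)"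
  unfolding ip_def sum_distrib_right by (rule sum.swap)

lemma norm_ip_le: "cmod (ip N x y) \<le> l2 N x * l2 N y"
proof -
  have "cmod (ip N x y) \<le> (\<Sum>i\<in>N. cmod (x i) * cmod (y i))"
    unfolding ip_def by (rule order_trans[OF norm_sum]) (simp add: norm_mult)
  also have "\<dots> \<le> l2 N x * l2 N y"
    using L2_set_mult_ineq[of "\<lambda>i. cmod (x i)" "\<lambda>i. cmod (y i)" N] by simp
  finally show ?thesis .
qed

lemma rank_one_sum_add:
  "rank_one_sum N A u \<xi> (\<lambda>i. x i + y i) = (\<lambda>i. rank_one_sum N A u \<xi> x i + rank_one_sum N A u \<xi> y i)"
  by (simp add: rank_one_sum_def ip_add_left algebra_simps sum.distrib)

lemma rank_one_sum_scale:
  "rank_one_sum N A u \<xi> (\<lambda>i. c * x i) = (\<lambda>i. c * rank_one_sum N A u \<xi> x i)"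
  by (simp add: rank_one_sum_def ip_scale_left algebra_simps sum_distrib_left)

lemma rank_one_sum_sum:
  "rank_one_sum N A u \<xi> (\<lambda>i. \<Sum>k\<in>K. x k i) = (\<lambda>i. \<Sum>k\<in>K. rank_one_sum N A u \<xi> (x k) i)"
  unfolding rank_one_sum_def ip_sum_left
  by (subst sum.swap) (simp add: sum_distrib_left sum_distrib_right)

lemma ip_rank_one_sum_left:
  "ip N (rank_one_sum N A u \<xi> x) y = (\<Sum>l\<in>A. of_real (\<xi> l) * ip N x (u l) * ip N (u l) y)"
  unfolding rank_one_sum_def by (simp add: ip_sum_left ip_scale_left)

text \<open>Self-adjointness of the operator, due to the weights being real.\<close>

lemma ip_rank_one_sum_right:
  "ip N x (rank_one_sum N A u \<xi> y) = ip N (rank_one_sum N A u \<xi> x) y"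
  by (subst cnj_ip[symmetric])
     (simp add: ip_rank_one_sum_left cnj_ip mult_ac del: ip_def)

lemma ip_power_right:
  "ip N x ((rank_one_sum N A u \<xi> ^^ q) y) = ip N ((rank_one_sum N A u \<xi> ^^ q) x) y"
proof (induction q arbitrary: x)
  case (Suc q)
  show ?case by (simp add: ip_rank_one_sum_right Suc) (simp add: funpow_swap1)
qed simp

lemma ip_power_add:
  "ip N ((rank_one_sum N A u \<xi> ^^ (p + q)) x) y =
   ip N ((rank_one_sum N A u \<xi> ^^ p) x) ((rank_one_sum N A u \<xi> ^^ q) y)"
  by (simp add: ip_power_right add.commute[of p q] funpow_add)

section \<open>Log-convexity of moments\<close>

lemma log_convex_le:
  fixes a :: "nat \<Rightarrow> real"
  assumes conv: "\<And>k. (a (Suc k))\<^sup>2 \<le> a k * a (Suc (Suc k))" and nonneg: "\<And>k. 0 \<le> a k"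
    and a0: "a 0 = 1" and R: "0 < R" "a s \<le> R ^ s" and "k \<le> s"
  shows "a k \<le> R ^ k"
proof (rule ccontr)
  assume "\<not> a k \<le> R ^ k"
  then have "R ^ k < a k" by simp
  with \<open>k \<le> s\<close> have "\<exists>j<s. a j \<le> R ^ j \<and> R ^ Suc j < a (Suc j)"
  proof (induction k)
    case (Suc k)
    show ?case
    proof (cases "a k \<le> R ^ k")
      case True
      with Suc.prems show ?thesis by (intro exI[of _ k]) auto
    qed (use Suc in auto)
  qed (simp add: a0)
  \<comment> \<open>The sequence starts on the curve \<open>R ^ k\<close> at \<open>k = 0\<close>
    and lies above it later, so it crosses between some \<open>j\<close> and \<open>j + 1\<close>;
    there its growth factor exceeds \<open>R\<close>.\<close>
  then obtain j where j: "j < s" "a j \<le> R ^ j" "R ^ Suc j < a (Suc j)"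
    by blast
  \<comment> \<open>Log-convexity keeps the growth factor above \<open>R\<close> from there on, so
    the sequence is still above the curve at \<open>s\<close>, against the bound assumed there.
    Products replace ratios because terms may vanish.\<close>
  have "R ^ (Suc j + i) < a (Suc j + i) \<and> R * a (j + i) < a (Suc j + i)" for i
  proof (induction i)
    case 0
    have "R * a j \<le> R ^ Suc j" using j R by simp
    with j show ?case by simp
  next
    case (Suc i)
    let ?x = "a (j + i)" and ?y = "a (Suc j + i)" and ?z = "a (Suc (Suc j + i))"
    have y: "0 < ?y" using Suc R by (meson zero_less_power less_trans)
    have *: "?y * ?y \<le> ?x * ?z"
      using conv[of "j + i"] by (simp add: power2_eq_square)
    moreover have "0 < ?y * ?y" using y by simp
    ultimately have "0 < ?x * ?z" by linarith
    then have z: "0 < ?z"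
      using nonneg[of "j + i"] by (simp add: zero_less_mult_iff)
    have "R * (?x * ?z) < ?y * ?z" using Suc z by (simp add: mult.assoc[symmetric])
    moreover have "?y * (R * ?y) \<le> R * (?x * ?z)"
      using mult_left_mono[OF *, of R] R(1) by (simp add: mult.left_commute)
    ultimately have "?y * (R * ?y) < ?y * ?z" by linarith
    with y have yz: "R * ?y < ?z" by (simp only: mult_less_cancel_left_pos)
    have "R * R ^ (Suc j + i) < R * ?y" using Suc R by simp
    with yz show ?case by simp
  qed
  from this[of "s - Suc j"] j R show False by simp
qed

text \<open>Moving one operator to the other side turns the squared norm into an inner product of
  the neighbouring iterates, to which Cauchy-Schwarz applies.\<close>

lemma sq_norm_power_le:
  "(l2 N ((rank_one_sum N A u \<xi> ^^ Suc k) x))\<^sup>2 \<le>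
   l2 N ((rank_one_sum N A u \<xi> ^^ k) x) * l2 N ((rank_one_sum N A u \<xi> ^^ Suc (Suc k)) x)"
proof -
  let ?H = "rank_one_sum N A u \<xi>"
  have "(l2 N ((?H ^^ Suc k) x))\<^sup>2 = cmod (ip N ((?H ^^ Suc k) x) ((?H ^^ Suc k) x))"
    by (simp add: ip_self norm_power del: funpow.simps)
  also have "ip N ((?H ^^ Suc k) x) ((?H ^^ Suc k) x) = ip N ((?H ^^ k) x) ((?H ^^ Suc (Suc k)) x)"
    by (simp add: ip_rank_one_sum_right)
  finally show ?thesis using norm_ip_le[of N "(?H ^^ k) x"] by metis
qed

lemma norm_power_le:
  assumes "l2 N x = 1" "0 < R" "l2 N ((rank_one_sum N A u \<xi> ^^ s) x) \<le> R ^ s" "k \<le> s"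
  shows "l2 N ((rank_one_sum N A u \<xi> ^^ k) x) \<le> R ^ k"
  using assms by (intro log_convex_le[of _ R s k] sq_norm_power_le) (simp_all)

text \<open>Self-adjointness splits the power between the two arguments with both exponents at most
  \<open>s\<close>; Cauchy-Schwarz and the norm bounds then multiply up to
  \<open>R ^ q\<close>.\<close>

lemma norm_ip_power_le:
  assumes "l2 N x = 1" "0 < R" "l2 N ((rank_one_sum N A u \<xi> ^^ s) x) \<le> R ^ s" "q \<le> 2 * s"
  shows "cmod (ip N ((rank_one_sum N A u \<xi> ^^ q) x) x) \<le> R ^ q"
proof -
  let ?H = "rank_one_sum N A u \<xi>"
  define k where "k = q div 2"
  have k: "q = (q - k) + k" "k \<le> s" "q - k \<le> s" using assms(4) by (auto simp: k_def)
  have "cmod (ip N ((?H ^^ q) x) x) = cmod (ip N ((?H ^^ (q - k)) x) ((?H ^^ k) x))"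
    by (subst k(1)) (simp only: ip_power_add)
  also have "\<dots> \<le> l2 N ((?H ^^ (q - k)) x) * l2 N ((?H ^^ k) x)" by (rule norm_ip_le)
  also have "\<dots> \<le> R ^ (q - k) * R ^ k"
    using assms k(2,3) by (intro mult_mono norm_power_le[OF assms(1-3)]) auto
  also have "\<dots> = R ^ q" by (simp add: k_def flip: power_add)
  finally show ?thesis .
qed

lemma ip_even_power:
  "ip N ((rank_one_sum N A u \<xi> ^^ (2 * s)) x) x = of_real ((l2 N ((rank_one_sum N A u \<xi> ^^ s) x))\<^sup>2)"
  by (simp add: mult_2 ip_power_add ip_self)

text \<open>A single number \<open>R\<close> dominates all moments up to the top even one. The
  maximum with 1 makes \<open>R ^ q\<close> increasing in \<open>q\<close>.\<close>

lemma max_moment_root: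
  assumes "l2 N x = 1"
  obtains R where "1 \<le> R" "R ^ (2 * s) = max 1 (Re (ip N ((rank_one_sum N A u \<xi> ^^ (2 * s)) x) x))"
    "\<And>q. q \<le> 2 * s \<Longrightarrow> cmod (ip N ((rank_one_sum N A u \<xi> ^^ q) x) x) \<le> R ^ q"
proof -
  let ?a = "l2 N ((rank_one_sum N A u \<xi> ^^ s) x)"
  obtain R where R: "1 \<le> R" "R ^ s = max 1 ?a"
  proof (cases "s = 0")
    case True
    \<comment> \<open>\<open>root 0\<close> is constantly \<open>0\<close>, so this exponent needs
      its own witness.\<close>
    then show ?thesis using that[of 1] assms by simp
  next
    case False
    then show ?thesis using that[of "root s (max 1 ?a)"] by (simp add: real_root_pow_pos2)
  qed
  show ?thesis
  proof
    show "1 \<le> R" by fact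
    have "max 1 ?a ^ 2 = max 1 (?a\<^sup>2)"
    proof (cases "1 \<le> ?a")
      case False
      then have "?a\<^sup>2 < 1" by (simp add: abs_square_less_1)
      with False show ?thesis by simp
    qed (simp add: max_def)
    then show "R ^ (2 * s) = max 1 (Re (ip N ((rank_one_sum N A u \<xi> ^^ (2 * s)) x) x))"
      using R by (simp add: ip_even_power power_even_eq)
    show "cmod (ip N ((rank_one_sum N A u \<xi> ^^ q) x) x) \<le> R ^ q" if "q \<le> 2 * s" for q
      using that R assms by (intro norm_ip_power_le[where s = s]) auto
  qed
qed

section \<open>Effect of changing a single weight\<close>

lemma rank_one_sum_fun_upd:
  assumes "finite A" "i \<in> A"
  shows "rank_one_sum N A u \<xi> x =
    (\<lambda>j. rank_one_sum N A u (\<xi>(i := c)) x j + of_real (\<xi> i - c) * ip N x (u i) * u i j)"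
  using assms by (simp add: rank_one_sum_def sum.remove algebra_simps)

text \<open>The telescoping identity \<open>H^q - B^q = \<Sum>j<q. B^j (H - B) H^(q-1-j)\<close>, in
  which \<open>H - B\<close> is the rank-one operator of \<open>u i\<close> with weight
  \<open>\<xi> i - c\<close>.\<close>

lemma power_perturbation:
  fixes u :: "'l \<Rightarrow> 'n \<Rightarrow> complex" and \<xi> :: "'l \<Rightarrow> real" and N :: "'n set" and c :: real
  assumes "finite A" "i \<in> A"
  defines "H \<equiv> rank_one_sum N A u \<xi>" and "B \<equiv> rank_one_sum N A u (\<xi>(i := c))"
  shows "(H ^^ q) x = (\<lambda>k. (B ^^ q) x k +
           (\<Sum>j<q. of_real (\<xi> i - c) * ip N ((H ^^ (q - 1 - j)) x) (u i) * (B ^^ j) (u i) k))"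
proof (induction q)
  case (Suc q)
  have step: "(H ^^ Suc q) x = (\<lambda>k. B ((H ^^ q) x) k + of_real (\<xi> i - c) * ip N ((H ^^ q) x) (u i) * u i k)"
    unfolding H_def B_def funpow.simps o_apply by (rule rank_one_sum_fun_upd[OF assms(1,2)])
  have "B ((H ^^ q) x) = (\<lambda>k. (B ^^ Suc q) x k +
      (\<Sum>j<q. of_real (\<xi> i - c) * ip N ((H ^^ (q - 1 - j)) x) (u i) * (B ^^ Suc j) (u i) k))"
    by (subst Suc) (simp add: B_def rank_one_sum_add rank_one_sum_sum rank_one_sum_scale)
  then show ?case
    unfolding step by (subst sum.lessThan_Suc_shift) (simp add: algebra_simps)
qed simp

text \<open>At the vector \<open>u i\<close> itself the telescoping identity closes up into scalars:
  the correction is a convolution of the two moment sequences.\<close>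

lemma ip_power_perturbation:
  fixes u :: "'l \<Rightarrow> 'n \<Rightarrow> complex" and \<xi> :: "'l \<Rightarrow> real" and N :: "'n set" and c :: real
  assumes "finite A" "i \<in> A"
  defines "H \<equiv> rank_one_sum N A u \<xi>" and "B \<equiv> rank_one_sum N A u (\<xi>(i := c))"
  shows "ip N ((H ^^ q) (u i)) (u i) = ip N ((B ^^ q) (u i)) (u i) + of_real (\<xi> i - c) *
    (\<Sum>j<q. ip N ((B ^^ j) (u i)) (u i) * ip N ((H ^^ (q - 1 - j)) (u i)) (u i))"
  unfolding H_def B_def
  by (subst power_perturbation[OF assms(1,2), where c = c])
     (simp add: ip_add_left ip_sum_left ip_scale_left sum_distrib_left, simp add: mult_ac)

lemma sum_powers_of_two: "(\<Sum>j<q. (2::real) ^ (q - Suc j)) = 2 ^ q - 1"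
  by (induction q) (simp_all add: sum.lessThan_Suc_shift del: sum.lessThan_Suc)

text \<open>By strong induction the convolution is at most \<open>R ^ q * (2 ^ q - 1)\<close>, which
  together with the unperturbed \<open>R ^ q\<close> gives exactly \<open>(2 * R) ^ q\<close>. The
  convolution only has total degree \<open>q - 1\<close>; \<open>1 \<le> R\<close> pays for the
  missing factor.\<close>

lemma perturbed_moment_le:
  assumes "finite A" "i \<in> A" and c: "\<bar>\<xi> i - c\<bar> \<le> 1" and R: "1 \<le> R"
    and B: "\<And>j. j \<le> q \<Longrightarrow> cmod (ip N ((rank_one_sum N A u (\<xi>(i := c)) ^^ j) (u i)) (u i)) \<le> R ^ j"
  shows "cmod (ip N ((rank_one_sum N A u \<xi> ^^ q) (u i)) (u i)) \<le> (2 * R) ^ q"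
  using B
proof (induction q rule: less_induct)
  case (less q)
  let ?h = "\<lambda>j. ip N ((rank_one_sum N A u \<xi> ^^ j) (u i)) (u i)"
  let ?b = "\<lambda>j. ip N ((rank_one_sum N A u (\<xi>(i := c)) ^^ j) (u i)) (u i)"
  have summand: "cmod (?b j * ?h (q - 1 - j)) \<le> R ^ q * 2 ^ (q - 1 - j)" if "j < q" for j
  proof -
    have "cmod (?b j * ?h (q - 1 - j)) \<le> R ^ j * (2 * R) ^ (q - 1 - j)"
      unfolding norm_mult
    proof (rule mult_mono)
      show "cmod (?b j) \<le> R ^ j" using that by (intro less.prems) simp
      show "cmod (?h (q - 1 - j)) \<le> (2 * R) ^ (q - 1 - j)"
        using that by (intro less.IH less.prems) auto
    qed (use R in auto)
    also have "\<dots> = R ^ (q - 1) * 2 ^ (q - 1 - j)"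
      using that by (simp add: power_mult_distrib flip: power_add)
    also have "\<dots> \<le> R ^ q * 2 ^ (q - 1 - j)"
      using R by (intro mult_right_mono power_increasing) auto
    finally show ?thesis .
  qed
  have "cmod (?h q) \<le> cmod (?b q) + \<bar>\<xi> i - c\<bar> * cmod (\<Sum>j<q. ?b j * ?h (q - 1 - j))"
    unfolding ip_power_perturbation[OF assms(1,2), where N = N and u = u and \<xi> = \<xi> and q = q and c = c]
    by (rule order_trans[OF norm_triangle_ineq]) (simp only: norm_mult norm_of_real order_refl)
  also have "\<dots> \<le> R ^ q + 1 * (\<Sum>j<q. R ^ q * 2 ^ (q - 1 - j))"
    using c by (intro add_mono mult_mono sum_norm_le less.prems summand) auto
  also have "\<dots> = (2 * R) ^ q"
    by (simp add: sum_powers_of_two power_mult_distrib algebra_simps flip: sum_distrib_left)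
  finally show ?case .
qed

section \<open>Traces\<close>

definition basis_fun :: "'n \<Rightarrow> 'n \<Rightarrow> complex" where
  "basis_fun i = (\<lambda>j. of_bool (j = i))"

definition power_trace ::
    "'n set \<Rightarrow> 'l set \<Rightarrow> ('l \<Rightarrow> 'n \<Rightarrow> complex) \<Rightarrow> ('l \<Rightarrow> real) \<Rightarrow> nat \<Rightarrow> complex" where
  "power_trace N A u \<xi> q =
     (\<Sum>i\<in>N. ip N ((rank_one_sum N A u \<xi> ^^ q) (basis_fun i)) (basis_fun i))"

lemma ip_basis_fun:
  assumes "finite N" "i \<in> N"
  shows "ip N x (basis_fun i) = x i"
  using assms by (simp add: ip_def basis_fun_def of_bool_def if_distrib[of cnj] if_distrib[of "(*) _"] cong: if_cong)

lemma ip_basis_fun_left: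
  assumes "finite N" "i \<in> N"
  shows "ip N (basis_fun i) x = cnj (x i)"
  using ip_basis_fun[OF assms, of x] by (metis cnj_ip)

lemma l2_basis_fun:
  assumes "finite N" "i \<in> N"
  shows "l2 N (basis_fun i) = 1"
proof -
  have "(cmod (basis_fun i j))\<^sup>2 = (if j = i then 1 else 0)" for j
    by (simp add: basis_fun_def)
  then show ?thesis using assms by (simp add: L2_set_def)
qed

text \<open>One factor of the power is split into its rank-one pieces, each contributing the trace
  of \<open>u l\<close> times its adjoint times \<open>H^q\<close>. This starts the moment
  recursion.\<close>

lemma power_trace_Suc:
  assumes "finite N"
  shows "power_trace N A u \<xi> (Suc q) =
    (\<Sum>l\<in>A. of_real (\<xi> l) * ip N ((rank_one_sum N A u \<xi> ^^ q) (u l)) (u l))"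
proof -
  let ?H = "rank_one_sum N A u \<xi>"
  have *: "ip N ((?H ^^ q) (basis_fun i)) (u l) = cnj ((?H ^^ q) (u l) i)" if "i \<in> N" for i l
    using assms that by (simp add: ip_basis_fun_left flip: ip_power_right)
  have "power_trace N A u \<xi> (Suc q) =
      (\<Sum>i\<in>N. \<Sum>l\<in>A. of_real (\<xi> l) * cnj ((?H ^^ q) (u l) i) * u l i)"
    using assms by (simp add: power_trace_def ip_rank_one_sum_left * ip_basis_fun)
  also have "\<dots> = (\<Sum>l\<in>A. of_real (\<xi> l) * ip N (u l) ((?H ^^ q) (u l)))"
    by (subst sum.swap) (simp add: ip_def sum_distrib_left mult_ac)
  finally show ?thesis by (simp add: ip_power_right)
qed

lemma power_trace_even:
  "power_trace N A u \<xi> (2 * s) =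
     of_real (\<Sum>i\<in>N. (l2 N ((rank_one_sum N A u \<xi> ^^ s) (basis_fun i)))\<^sup>2)"
  by (simp add: power_trace_def ip_even_power)

text \<open>The trace of the even power is the squared Frobenius norm of \<open>H^s\<close>, which
  dominates the squared operator norm.\<close>

lemma norm_power_le_trace:
  assumes "finite N"
  shows "(l2 N ((rank_one_sum N A u \<xi> ^^ s) x))\<^sup>2 \<le> (l2 N x)\<^sup>2 * Re (power_trace N A u \<xi> (2 * s))"
proof -
  let ?H = "rank_one_sum N A u \<xi>"
  have "(l2 N ((?H ^^ s) x))\<^sup>2 = (\<Sum>i\<in>N. (cmod ((?H ^^ s) x i))\<^sup>2)"
    by (simp add: L2_set_def sum_nonneg)
  also have "\<dots> \<le> (\<Sum>i\<in>N. (l2 N x)\<^sup>2 * (l2 N ((?H ^^ s) (basis_fun i)))\<^sup>2)"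
  proof (rule sum_mono)
    fix i assume "i \<in> N"
    then have "(?H ^^ s) x i = ip N x ((?H ^^ s) (basis_fun i))"
      using assms by (simp add: ip_power_right ip_basis_fun)
    then show "(cmod ((?H ^^ s) x i))\<^sup>2 \<le> (l2 N x)\<^sup>2 * (l2 N ((?H ^^ s) (basis_fun i)))\<^sup>2"
      by (simp add: norm_ip_le power_mono flip: power_mult_distrib)
  qed
  finally show ?thesis by (simp add: power_trace_even sum_distrib_left)
qed

lemma ip_rank_one_sum_self:
  "ip N (rank_one_sum N A u \<xi> x) x = of_real (\<Sum>l\<in>A. \<xi> l * (cmod (ip N x (u l)))\<^sup>2)"
  by (simp add: ip_rank_one_sum_left norm_ip_square mult.assoc)

text \<open>Log-convexity takes the place of a spectral decomposition: a bound on the norm of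
  \<open>H^s x\<close> descends to the first moment, which is the quadratic form.\<close>

lemma quadratic_form_le_of_trace:
  assumes "finite N" "l2 N x = 1" "0 < R" "0 < s" "Re (power_trace N A u \<xi> (2 * s)) \<le> R ^ (2 * s)"
  shows "\<bar>\<Sum>l\<in>A. \<xi> l * (cmod (ip N x (u l)))\<^sup>2\<bar> \<le> R"
proof -
  have "(l2 N ((rank_one_sum N A u \<xi> ^^ s) x))\<^sup>2 \<le>
      (l2 N x)\<^sup>2 * Re (power_trace N A u \<xi> (2 * s))"
    by (rule norm_power_le_trace[OF assms(1)])
  also have "\<dots> \<le> (R ^ s)\<^sup>2"
    using assms(2,5) by (simp add: power_even_eq)
  finally have "l2 N ((rank_one_sum N A u \<xi> ^^ s) x) \<le> R ^ s"
    by (rule power2_le_imp_le) (use assms(3) in simp)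
  then show ?thesis
    using norm_ip_power_le[where N = N and x = x and R = R and A = A and u = u and \<xi> = \<xi> and s = s and q = 1] assms(2-4)
    by (simp add: ip_rank_one_sum_self del: of_real_sum of_real_mult of_real_power)
qed

text \<open>\<open>B\<close> does not involve the weight \<open>\<xi> i\<close>. The term linear in
  \<open>\<xi> i\<close> is therefore kept exact, since it will average to zero; the rest carries
  the square of the weight and a convolution whose geometric sum is below
  \<open>2 ^ Suc (2 * s)\<close>.\<close>

lemma moment_step:
  fixes u :: "'l \<Rightarrow> 'n \<Rightarrow> complex" and \<xi> :: "'l \<Rightarrow> real" and N :: "'n set"
  assumes "finite A" "i \<in> A" "\<bar>\<xi> i\<bar> \<le> 1" "l2 N (u i) = 1"
  defines "H \<equiv> rank_one_sum N A u \<xi>" and "B \<equiv> rank_one_sum N A u (\<xi>(i := 0))"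
  shows "\<xi> i * Re (ip N ((H ^^ Suc (2 * s)) (u i)) (u i)) \<le>
    \<xi> i * Re (ip N ((B ^^ Suc (2 * s)) (u i)) (u i)) +
    (\<xi> i)\<^sup>2 * (2 ^ Suc (2 * s) * max 1 (Re (ip N ((B ^^ (2 * s)) (u i)) (u i))))"
proof -
  let ?h = "\<lambda>q. ip N ((H ^^ q) (u i)) (u i)"
  let ?b = "\<lambda>q. ip N ((B ^^ q) (u i)) (u i)"
  let ?S = "\<Sum>j<Suc (2 * s). ?b j * ?h (2 * s - j)"
  obtain R where R: "1 \<le> R" "R ^ (2 * s) = max 1 (Re (?b (2 * s)))"
      "\<And>q. q \<le> 2 * s \<Longrightarrow> cmod (?b q) \<le> R ^ q"
    unfolding B_def using max_moment_root[OF assms(4)] by blast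
  have h: "cmod (?h q) \<le> (2 * R) ^ q" if "q \<le> 2 * s" for q
    unfolding H_def using assms R that
    by (intro perturbed_moment_le[where c = 0]) (auto simp: B_def)
  have "cmod ?S \<le> (\<Sum>j<Suc (2 * s). R ^ (2 * s) * 2 ^ (2 * s - j))"
  proof (rule sum_norm_le)
    fix j assume j: "j \<in> {..<Suc (2 * s)}"
    have "cmod (?b j * ?h (2 * s - j)) \<le> R ^ j * (2 * R) ^ (2 * s - j)"
      unfolding norm_mult using j R(1) by (intro mult_mono R(3) h) auto
    also have "\<dots> = R ^ (2 * s) * 2 ^ (2 * s - j)"
      using j by (simp add: power_mult_distrib flip: power_add)
    finally show "cmod (?b j * ?h (2 * s - j)) \<le> R ^ (2 * s) * 2 ^ (2 * s - j)" .
  qed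
  also have "\<dots> = R ^ (2 * s) * (2 ^ Suc (2 * s) - 1)"
    using sum_powers_of_two[of "Suc (2 * s)"]
    by (simp flip: sum_distrib_left del: sum.lessThan_Suc)
  also have "\<dots> \<le> 2 ^ Suc (2 * s) * max 1 (Re (?b (2 * s)))"
    unfolding R(2) by (simp add: algebra_simps)
  finally have S: "Re ?S \<le> 2 ^ Suc (2 * s) * max 1 (Re (?b (2 * s)))"
    using complex_Re_le_cmod order_trans by blast
  have "?h (Suc (2 * s)) = ?b (Suc (2 * s)) + of_real (\<xi> i) * ?S"
    unfolding H_def B_def
    by (subst ip_power_perturbation[OF assms(1,2), where c = 0]) simp
  then have "\<xi> i * Re (?h (Suc (2 * s))) = \<xi> i * Re (?b (Suc (2 * s))) + (\<xi> i)\<^sup>2 * Re ?S"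
    by (simp add: power2_eq_square algebra_simps del: sum.lessThan_Suc funpow.simps)
  with S show ?thesis by (simp add: mult_left_mono del: sum.lessThan_Suc funpow.simps)
qed

text \<open>The way back from \<open>B\<close> to \<open>H\<close>, so that the recursion stays
  within moments of \<open>H\<close>. It is the same perturbation estimate with the old weight
  restored, hence the factor \<open>2 ^ (2 * s) = 4 ^ s\<close>.\<close>

lemma moment_compare:
  fixes u :: "'l \<Rightarrow> 'n \<Rightarrow> complex" and \<xi> :: "'l \<Rightarrow> real" and N :: "'n set"
  assumes "finite A" "i \<in> A" "\<bar>\<xi> i\<bar> \<le> 1" "l2 N (u i) = 1"
  defines "H \<equiv> rank_one_sum N A u \<xi>" and "B \<equiv> rank_one_sum N A u (\<xi>(i := 0))"
  shows "max 1 (Re (ip N ((B ^^ (2 * s)) (u i)) (u i))) \<le>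
    4 ^ s * (1 + Re (ip N ((H ^^ (2 * s)) (u i)) (u i)))"
proof -
  obtain R where R: "1 \<le> R" "R ^ (2 * s) = max 1 (Re (ip N ((H ^^ (2 * s)) (u i)) (u i)))"
      "\<And>q. q \<le> 2 * s \<Longrightarrow> cmod (ip N ((H ^^ q) (u i)) (u i)) \<le> R ^ q"
    unfolding H_def using max_moment_root[OF assms(4)] by blast
  have nonneg: "0 \<le> Re (ip N ((H ^^ (2 * s)) (u i)) (u i))"
    unfolding H_def by (simp add: ip_even_power)
  have "Re (ip N ((B ^^ (2 * s)) (u i)) (u i)) \<le> (2 * R) ^ (2 * s)"
    unfolding B_def using assms R
    by (intro order_trans[OF complex_Re_le_cmod] perturbed_moment_le[where c = "\<xi> i"]) auto
  moreover have "1 \<le> (2 * R) ^ (2 * s)" using R(1) by (intro one_le_power) simp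
  ultimately have "max 1 (Re (ip N ((B ^^ (2 * s)) (u i)) (u i))) \<le> (2 * R) ^ (2 * s)" by simp
  also have "\<dots> = 4 ^ s * max 1 (Re (ip N ((H ^^ (2 * s)) (u i)) (u i)))"
    unfolding R(2)[symmetric] by (simp add: power_mult_distrib power_mult)
  also have "\<dots> \<le> 4 ^ s * (1 + Re (ip N ((H ^^ (2 * s)) (u i)) (u i)))"
    using nonneg by simp
  finally show ?thesis .
qed

section \<open>Resampling one Bernoulli coordinate\<close>

lemma finite_set_Pi_pmf:
  assumes "finite A" "\<And>x. finite (set_pmf (p x))"
  shows "finite (set_pmf (Pi_pmf A d p))"
  using assms by (intro finite_subset[OF set_Pi_pmf_subset'] finite_PiE_dflt) auto

text \<open>Conditioning on the coordinates other than \<open>i\<close>. Both sides use the full law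
  \<open>P\<close>, so factors not depending on coordinate \<open>i\<close> can be treated without a
  change of space.\<close>

lemma expectation_Pi_bernoulli_resample:
  fixes F :: "('a \<Rightarrow> bool) \<Rightarrow> real"
  assumes A: "finite A" "i \<in> A" and t: "0 \<le> t" "t \<le> 1"
  defines "P \<equiv> Pi_pmf A False (\<lambda>_. bernoulli_pmf t)"
  shows "measure_pmf.expectation P F =
    measure_pmf.expectation P (\<lambda>b. t * F (b(i := True)) + (1 - t) * F (b(i := False)))"
proof -
  define Q where "Q = Pi_pmf (A - {i}) False (\<lambda>_. bernoulli_pmf t)"
  have fin: "finite (set_pmf Q)" unfolding Q_def using A by (intro finite_set_Pi_pmf) auto
  have P: "P = bernoulli_pmf t \<bind> (\<lambda>y. map_pmf (\<lambda>f. f(i := y)) Q)"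
    using Pi_pmf_insert'[of "A - {i}" i False "\<lambda>_. bernoulli_pmf t"] A
    by (simp add: P_def Q_def insert_absorb map_pmf_def)
  have *: "measure_pmf.expectation P G =
      measure_pmf.expectation Q (\<lambda>b. t * G (b(i := True)) + (1 - t) * G (b(i := False)))" for G :: "_ \<Rightarrow> real"
    unfolding P using fin t
    by (subst pmf_expectation_bind[of UNIV])
       (simp_all add: UNIV_bool subset_iff integrable_measure_pmf_finite)
  \<comment> \<open>The right-hand integrand ignores coordinate \<open>i\<close>, so integrating
    that coordinate out reduces both sides to the same expectation over \<open>Q\<close>.\<close>
  show ?thesis by (subst (1 2) *) (simp add: algebra_simps)
qed

section \<open>Random weights on tight frames\<close>

definition centered :: "real \<Rightarrow> ('l \<Rightarrow> bool) \<Rightarrow> 'l \<Rightarrow> real" where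
  "centered t b = (\<lambda>l. of_bool (b l) - t)"

lemma abs_centered_le: "0 \<le> t \<Longrightarrow> t \<le> 1 \<Longrightarrow> \<bar>centered t b l\<bar> \<le> 1"
  by (simp add: centered_def of_bool_def)

text \<open>Once the weight at \<open>i\<close> is zeroed, the operator no longer sees coordinate
  \<open>i\<close>; independence enters in this form.\<close>

lemma centered_fun_upd: "(centered t (b(i := y)))(i := 0) = (centered t b)(i := 0)"
  by (simp add: centered_def fun_eq_iff)

text \<open>The constants produced by the trace recursion: \<open>2 * 16 ^ s\<close> is the cost of
  one step, and the summand 1 accounts for its dimension term.\<close>

fun moment_const :: "nat \<Rightarrow> real" where
  "moment_const 0 = 1"
| "moment_const (Suc s) = 2 * 16 ^ s * (1 + moment_const s)"

text \<open>These are the properties of the Gabor system on which the moment bound rests;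
  \<open>tight\<close> says entrywise that the frame operator is \<open>c\<close> times the
  identity.\<close>

locale tight_unit_frame =
  fixes N :: "'n set" and A :: "'l set" and u :: "'l \<Rightarrow> 'n \<Rightarrow> complex" and c :: real
  assumes finite_N: "finite N" and finite_A: "finite A"
    and unit: "l \<in> A \<Longrightarrow> l2 N (u l) = 1"
    and tight: "i \<in> N \<Longrightarrow> j \<in> N \<Longrightarrow> (\<Sum>l\<in>A. u l i * cnj (u l j)) = (if i = j then of_real c else 0)"
begin

text \<open>The left-hand side is the trace of \<open>H^q\<close> times the frame operator, and the
  latter is \<open>c\<close> times the identity.\<close>

lemma sum_ip_power:
  "(\<Sum>l\<in>A. ip N ((rank_one_sum N A u \<xi> ^^ q) (u l)) (u l)) = of_real c * power_trace N A u \<xi> q"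
proof -
  let ?H = "rank_one_sum N A u \<xi>"
  have H: "(?H ^^ q) x i = (\<Sum>j\<in>N. x j * cnj ((?H ^^ q) (basis_fun i) j))" if "i \<in> N" for x i
    using finite_N that by (simp flip: ip_def add: ip_power_right ip_basis_fun)
  have "(\<Sum>l\<in>A. ip N ((?H ^^ q) (u l)) (u l)) =
      (\<Sum>l\<in>A. \<Sum>i\<in>N. \<Sum>j\<in>N. u l j * cnj (u l i) * cnj ((?H ^^ q) (basis_fun i) j))"
    unfolding ip_def by (intro sum.cong refl, subst H) (simp_all add: sum_distrib_left mult_ac)
  also have "\<dots> = (\<Sum>i\<in>N. \<Sum>l\<in>A. \<Sum>j\<in>N. u l j * cnj (u l i) * cnj ((?H ^^ q) (basis_fun i) j))"
    by (rule sum.swap)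
  also have "\<dots> = (\<Sum>i\<in>N. \<Sum>j\<in>N. (\<Sum>l\<in>A. u l j * cnj (u l i)) * cnj ((?H ^^ q) (basis_fun i) j))"
    by (intro sum.cong refl, subst sum.swap) (simp add: sum_distrib_right)
  also have "\<dots> = (\<Sum>i\<in>N. of_real c * cnj ((?H ^^ q) (basis_fun i) i))"
    using finite_N by (simp add: tight if_distrib[of "\<lambda>z. z * _"] cong: if_cong)
  also have "\<dots> = (\<Sum>i\<in>N. of_real c * ip N (basis_fun i) ((?H ^^ q) (basis_fun i)))"
    using finite_N by (simp add: ip_basis_fun flip: cnj_ip[of N _ "basis_fun _"])
  finally show ?thesis by (simp add: power_trace_def sum_distrib_left ip_power_right)
qed

lemma power_trace_0: "power_trace N A u \<xi> 0 = of_nat (card N)"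
  using finite_N by (simp add: power_trace_def ip_basis_fun) (simp add: basis_fun_def)

lemma card_frame: "real (card A) = c * real (card N)"
proof -
  have "(of_nat (card A) :: complex) = (\<Sum>l\<in>A. ip N (u l) (u l))"
    by (simp add: ip_self unit)
  also have "\<dots> = of_real c * of_nat (card N)"
    using sum_ip_power[where q = 0 and \<xi> = "\<lambda>_. 0"] by (simp add: power_trace_0)
  finally have "complex_of_real (real (card A)) = of_real (c * real (card N))" by simp
  then show ?thesis by (simp only: of_real_eq_iff)
qed

lemma sum_frame_coeff:
  "(\<Sum>l\<in>A. (cmod (ip N x (u l)))\<^sup>2) = c * (l2 N x)\<^sup>2"
proof -
  have "of_real (\<Sum>l\<in>A. (cmod (ip N x (u l)))\<^sup>2) = (\<Sum>l\<in>A. ip N x (u l) * ip N (u l) x)"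
    by (simp add: norm_ip_square)
  also have "\<dots> = (\<Sum>l\<in>A. \<Sum>i\<in>N. \<Sum>j\<in>N. u l j * cnj (u l i) * (x i * cnj (x j)))"
    by (simp add: ip_def sum_product mult_ac)
  also have "\<dots> = (\<Sum>i\<in>N. \<Sum>l\<in>A. \<Sum>j\<in>N. u l j * cnj (u l i) * (x i * cnj (x j)))"
    by (rule sum.swap)
  also have "\<dots> = (\<Sum>i\<in>N. \<Sum>j\<in>N. (\<Sum>l\<in>A. u l j * cnj (u l i)) * (x i * cnj (x j)))"
    by (intro sum.cong refl, subst sum.swap) (simp add: sum_distrib_right)
  also have "\<dots> = (\<Sum>i\<in>N. of_real c * (x i * cnj (x i)))"
    using finite_N by (simp add: tight if_distrib[of "\<lambda>z. z * _"] cong: if_cong)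
  also have "\<dots> = of_real c * ip N x x"
    by (simp add: ip_def sum_distrib_left)
  also have "\<dots> = of_real (c * (l2 N x)\<^sup>2)"
    by (simp add: ip_self)
  finally show ?thesis by (simp only: of_real_eq_iff)
qed

section \<open>Expected traces and the tail bound\<close>

context
  fixes t :: real
  assumes t: "0 \<le> t" "t \<le> 1"
begin

abbreviation "P \<equiv> Pi_pmf A False (\<lambda>_. bernoulli_pmf t)"

abbreviation "tr b q \<equiv> Re (power_trace N A u (centered t b) q)"

abbreviation "mom \<xi> l q \<equiv> Re (ip N ((rank_one_sum N A u \<xi> ^^ q) (u l)) (u l))"

lemma integrable_P: "integrable (measure_pmf P) (F :: ('l \<Rightarrow> bool) \<Rightarrow> real)"
  using finite_A by (intro integrable_measure_pmf_finite finite_set_Pi_pmf) auto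

text \<open>The expectation of \<open>moment_step\<close>: the linear term vanishes and the square
  of the weight yields a factor \<open>t\<close>. The constant is \<open>2 ^ Suc (2 * s)\<close>
  from \<open>moment_step\<close> times \<open>4 ^ s\<close> from
  \<open>moment_compare\<close>.\<close>

lemma expected_moment_step:
  assumes l: "l \<in> A"
  shows "measure_pmf.expectation P (\<lambda>b. centered t b l * mom (centered t b) l (Suc (2 * s))) \<le>
    2 * 16 ^ s * t * measure_pmf.expectation P (\<lambda>b. 1 + mom (centered t b) l (2 * s))"
proof -
  define f where "f b = mom ((centered t b)(l := 0)) l (Suc (2 * s))" for b
  define g where "g b = max 1 (mom ((centered t b)(l := 0)) l (2 * s))" for b
  have f_upd: "f (b(l := y)) = f b" and g_upd: "g (b(l := y)) = g b" for b y
    by (simp_all add: f_def g_def centered_fun_upd)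
  \<comment> \<open>Resampling coordinate \<open>l\<close> leaves \<open>f\<close> fixed and
    averages the weight to \<open>t * (1 - t) + (1 - t) * (- t) = 0\<close>.\<close>
  have "measure_pmf.expectation P (\<lambda>b. centered t b l * f b) = 0"
    by (subst expectation_Pi_bernoulli_resample[OF finite_A l t])
       (simp add: f_upd centered_def algebra_simps)
  moreover have le1: "measure_pmf.expectation P (\<lambda>b. (centered t b l)\<^sup>2 * g b) \<le>
      measure_pmf.expectation P (\<lambda>b. t * g b)"
  proof (subst expectation_Pi_bernoulli_resample[OF finite_A l t], rule integral_mono[OF integrable_P integrable_P])
    fix b
    \<comment> \<open>This is the variance of the weight. Its bound by \<open>t\<close>, rather than
      by 1, is the gain of each recursion step.\<close>
    have "t * (1 - t)\<^sup>2 + (1 - t) * t\<^sup>2 = t * (1 - t)"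
      by (simp add: power2_eq_square algebra_simps)
    also have "\<dots> \<le> t" using t by (simp add: mult_left_le)
    finally have "(t * (1 - t)\<^sup>2 + (1 - t) * t\<^sup>2) * g b \<le> t * g b"
      by (intro mult_right_mono) (auto simp: g_def)
    then show "t * ((centered t (b(l := True)) l)\<^sup>2 * g (b(l := True))) +
        (1 - t) * ((centered t (b(l := False)) l)\<^sup>2 * g (b(l := False))) \<le> t * g b"
      by (simp add: g_upd centered_def algebra_simps)
  qed
  moreover have le2: "measure_pmf.expectation P (\<lambda>b. t * g b) \<le>
      measure_pmf.expectation P (\<lambda>b. t * (4 ^ s * (1 + mom (centered t b) l (2 * s))))"
    unfolding g_def using l t
    by (intro integral_mono[OF integrable_P integrable_P] mult_left_mono moment_compare
          finite_A abs_centered_le unit)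
  moreover have "measure_pmf.expectation P (\<lambda>b. centered t b l * mom (centered t b) l (Suc (2 * s))) \<le>
      measure_pmf.expectation P (\<lambda>b. centered t b l * f b + (centered t b l)\<^sup>2 * (2 ^ Suc (2 * s) * g b))"
    unfolding f_def g_def using l t
    by (intro integral_mono[OF integrable_P integrable_P] moment_step finite_A abs_centered_le unit)
  moreover have "measure_pmf.expectation P (\<lambda>b. centered t b l * f b + (centered t b l)\<^sup>2 * (2 ^ Suc (2 * s) * g b)) =
      measure_pmf.expectation P (\<lambda>b. centered t b l * f b) +
      2 ^ Suc (2 * s) * measure_pmf.expectation P (\<lambda>b. (centered t b l)\<^sup>2 * g b)"
    by (subst Bochner_Integration.integral_add[OF integrable_P integrable_P])
       (simp only: mult.left_commute[of _ "2 ^ Suc (2 * s)"] integral_mult_right_zero)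
  ultimately have "measure_pmf.expectation P (\<lambda>b. centered t b l * mom (centered t b) l (Suc (2 * s))) \<le>
      2 ^ Suc (2 * s) * measure_pmf.expectation P (\<lambda>b. t * (4 ^ s * (1 + mom (centered t b) l (2 * s))))"
    using mult_left_mono[OF order_trans[OF le1 le2], of "2 ^ Suc (2 * s)", OF zero_le_power[OF zero_le_numeral]] by linarith
  also have "\<dots> = 2 * 16 ^ s * t * measure_pmf.expectation P (\<lambda>b. 1 + mom (centered t b) l (2 * s))"
    by (simp add: power_mult flip: power_mult_distrib)
  finally show ?thesis .
qed

text \<open>Tightness turns the moments at the frame vectors back into a trace, which closes the
  recursion; the summands 1 add up to \<open>card A = c * card N\<close>.\<close>

lemma expected_trace_step:
  "measure_pmf.expectation P (\<lambda>b. tr b (2 * Suc s)) \<le>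
    2 * 16 ^ s * (t * c) * (real (card N) + measure_pmf.expectation P (\<lambda>b. tr b (2 * s)))"
proof -
  have "tr b (2 * Suc s) = (\<Sum>l\<in>A. centered t b l * mom (centered t b) l (Suc (2 * s)))" for b
    using power_trace_Suc[OF finite_N, where A = A and u = u and \<xi> = "centered t b" and q = "Suc (2 * s)"]
    by (simp del: funpow.simps)
  then have "measure_pmf.expectation P (\<lambda>b. tr b (2 * Suc s)) =
      (\<Sum>l\<in>A. measure_pmf.expectation P (\<lambda>b. centered t b l * mom (centered t b) l (Suc (2 * s))))"
    by (simp only: Bochner_Integration.integral_sum[OF integrable_P])
  also have "\<dots> \<le> (\<Sum>l\<in>A. 2 * 16 ^ s * t * measure_pmf.expectation P (\<lambda>b. 1 + mom (centered t b) l (2 * s)))"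
    by (intro sum_mono expected_moment_step)
  also have "\<dots> = 2 * 16 ^ s * t * measure_pmf.expectation P (\<lambda>b. \<Sum>l\<in>A. 1 + mom (centered t b) l (2 * s))"
    by (simp only: Bochner_Integration.integral_sum[OF integrable_P] sum_distrib_left)
  also have "(\<lambda>b. \<Sum>l\<in>A. 1 + mom (centered t b) l (2 * s)) = (\<lambda>b. c * (real (card N) + tr b (2 * s)))"
  proof
    fix b
    have "(\<Sum>l\<in>A. mom (centered t b) l (2 * s)) = c * tr b (2 * s)"
      using sum_ip_power[where \<xi> = "centered t b" and q = "2 * s"] by (simp flip: Re_sum)
    then show "(\<Sum>l\<in>A. 1 + mom (centered t b) l (2 * s)) = c * (real (card N) + tr b (2 * s))"
      using card_frame by (simp add: sum.distrib distrib_left)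
  qed
  also have "measure_pmf.expectation P (\<lambda>b. c * (real (card N) + tr b (2 * s))) =
      c * (real (card N) + measure_pmf.expectation P (\<lambda>b. tr b (2 * s)))"
    by (simp add: Bochner_Integration.integral_add[OF integrable_P integrable_P])
  finally show ?thesis by (simp add: mult_ac)
qed

lemma expected_trace_le:
  assumes "1 \<le> t * c"
  shows "measure_pmf.expectation P (\<lambda>b. tr b (2 * s)) \<le> moment_const s * real (card N) * (t * c) ^ s"
proof (induction s)
  case 0
  then show ?case by (simp add: power_trace_0)
next
  case (Suc s)
  have "measure_pmf.expectation P (\<lambda>b. tr b (2 * Suc s)) \<le>
      2 * 16 ^ s * (t * c) * (real (card N) + measure_pmf.expectation P (\<lambda>b. tr b (2 * s)))"
    by (rule expected_trace_step)
  \<comment> \<open>\<open>1 \<le> t * c\<close> lets the dimension term be absorbed into the power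
    of \<open>t * c\<close>.\<close>
  also have "\<dots> \<le> 2 * 16 ^ s * (t * c) *
      (real (card N) * (t * c) ^ s + moment_const s * real (card N) * (t * c) ^ s)"
    using Suc assms by (intro mult_left_mono add_mono) (auto simp: mult_le_cancel_left1)
  finally show ?case by (simp add: algebra_simps)
qed

text \<open>Markov's inequality. The threshold has the power \<open>2 * s\<close> of
  \<open>t * c\<close>, the expectation only the power \<open>s\<close>; the surplus has to outweigh
  the dimension.\<close>

lemma prob_trace_gt_le:
  assumes "1 \<le> t * c" "0 < \<eta>"
  shows "measure_pmf.prob P {b. (\<eta> * (t * c)) ^ (2 * s) < tr b (2 * s)} \<le>
    moment_const s * real (card N) / (\<eta> ^ (2 * s) * (t * c) ^ s)"
proof -
  have nonneg: "0 \<le> tr b (2 * s)" for b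
    by (simp add: power_trace_even sum_nonneg)
  have pos: "0 < \<eta> * (t * c)" using assms by simp
  have "measure_pmf.prob P {b. (\<eta> * (t * c)) ^ (2 * s) < tr b (2 * s)} \<le>
      measure_pmf.prob P {b \<in> space (measure_pmf P). (\<eta> * (t * c)) ^ (2 * s) \<le> tr b (2 * s)}"
    by (intro measure_pmf.finite_measure_mono) auto
  also have "\<dots> \<le> measure_pmf.expectation P (\<lambda>b. tr b (2 * s)) / (\<eta> * (t * c)) ^ (2 * s)"
    using pos nonneg by (intro integral_Markov_inequality_measure[OF integrable_P, where A = UNIV] zero_less_power) auto
  also have "\<dots> \<le> moment_const s * real (card N) * (t * c) ^ s / (\<eta> * (t * c)) ^ (2 * s)"
    using pos by (intro divide_right_mono expected_trace_le assms) auto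
  also have "\<dots> = moment_const s * real (card N) / (\<eta> ^ (2 * s) * (t * c) ^ s)"
    using assms by (simp add: power_mult_distrib mult_2 power_add)
  finally show ?thesis .
qed

end

lemma frame_bounds_of_trace:
  assumes "\<Lambda> \<subseteq> A" "0 < s" "0 < \<eta> * (t * c)" "l2 N x = 1"
    and "Re (power_trace N A u (centered t (\<lambda>l. l \<in> \<Lambda>)) (2 * s)) \<le> (\<eta> * (t * c)) ^ (2 * s)"
  shows "\<bar>(\<Sum>l\<in>\<Lambda>. (cmod (ip N x (u l)))\<^sup>2) - t * c\<bar> \<le> \<eta> * (t * c)"
proof -
  \<comment> \<open>The quadratic form of the centred operator is the frame sum over
    \<open>\<Lambda>\<close> minus \<open>t\<close> times the full frame sum, and the latter equals
    \<open>c\<close> at a unit vector.\<close>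
  have "(\<Sum>l\<in>A. centered t (\<lambda>l. l \<in> \<Lambda>) l * (cmod (ip N x (u l)))\<^sup>2) =
      (\<Sum>l\<in>A. of_bool (l \<in> \<Lambda>) * (cmod (ip N x (u l)))\<^sup>2) - t * (\<Sum>l\<in>A. (cmod (ip N x (u l)))\<^sup>2)"
    by (simp add: centered_def left_diff_distrib sum_subtractf sum_distrib_left)
  also have "(\<Sum>l\<in>A. of_bool (l \<in> \<Lambda>) * (cmod (ip N x (u l)))\<^sup>2) = (\<Sum>l\<in>\<Lambda>. (cmod (ip N x (u l)))\<^sup>2)"
    using assms(1) finite_A by (intro sum.mono_neutral_cong_right) auto
  finally show ?thesis
    using quadratic_form_le_of_trace[OF finite_N assms(4,3,2,5)] by (simp add: sum_frame_coeff assms(4))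
qed

text \<open>Both sides are the trace of the frame operator of \<open>\<Lambda>\<close>, read off
  from the unit norms and from the standard basis.\<close>

lemma card_eq_sum_basis:
  assumes "\<Lambda> \<subseteq> A"
  shows "real (card \<Lambda>) = (\<Sum>i\<in>N. \<Sum>l\<in>\<Lambda>. (cmod (ip N (basis_fun i) (u l)))\<^sup>2)"
proof -
  have "(\<Sum>i\<in>N. \<Sum>l\<in>\<Lambda>. (cmod (ip N (basis_fun i) (u l)))\<^sup>2) = (\<Sum>l\<in>\<Lambda>. \<Sum>i\<in>N. (cmod (u l i))\<^sup>2)"
    by (subst sum.swap) (simp add: ip_basis_fun finite_N flip: cnj_ip[of N "u _"])
  also have "\<dots> = (\<Sum>l\<in>\<Lambda>. (l2 N (u l))\<^sup>2)"
    by (simp add: L2_set_def sum_nonneg)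
  also have "\<dots> = real (card \<Lambda>)"
    using assms unit by (simp add: subset_iff)
  finally show ?thesis ..
qed

text \<open>The trace of the frame operator is the number of frame vectors, so the same event also
  controls the normalisation by the random cardinality.\<close>
lemma frame_bounds_relative:
  assumes "\<Lambda> \<subseteq> A" "0 < s" "0 < t * c" "0 < \<eta>" "3 * \<eta> \<le> \<delta>" "3 * \<eta> \<le> 1" "l2 N x = 1"
    and trace: "Re (power_trace N A u (centered t (\<lambda>l. l \<in> \<Lambda>)) (2 * s)) \<le> (\<eta> * (t * c)) ^ (2 * s)"
  shows "real (card \<Lambda>) / real (card N) * (1 - \<delta>) \<le> (\<Sum>l\<in>\<Lambda>. (cmod (ip N x (u l)))\<^sup>2)"
    and "(\<Sum>l\<in>\<Lambda>. (cmod (ip N x (u l)))\<^sup>2) \<le> real (card \<Lambda>) / real (card N) * (1 + \<delta>)"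
proof -
  define q where "q x = (\<Sum>l\<in>\<Lambda>. (cmod (ip N x (u l)))\<^sup>2)" for x
  define \<rho> where "\<rho> = real (card \<Lambda>) / real (card N)"
  define a where "a = t * c"
  have a: "0 < a" using assms by (simp add: a_def)
  have q: "(1 - \<eta>) * a \<le> q x" "q x \<le> (1 + \<eta>) * a" if "l2 N x = 1" for x
    using frame_bounds_of_trace[OF assms(1,2) _ that trace] assms(3,4)
    by (auto simp: q_def a_def algebra_simps abs_le_iff)
  \<comment> \<open>Over an empty index set no vector has norm 1.\<close>
  have N: "0 < card N"
    using finite_N assms(7) by (auto simp: card_gt_0_iff)
  have card: "real (card \<Lambda>) = (\<Sum>i\<in>N. q (basis_fun i))"
    using card_eq_sum_basis[OF assms(1)] by (simp add: q_def)
  \<comment> \<open>Averaging the bounds on \<open>q\<close> over the standard basis shows that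
    \<open>\<rho>\<close> lies within the same distance of \<open>a\<close>.\<close>
  have "(\<Sum>i\<in>N. (1 - \<eta>) * a) \<le> real (card \<Lambda>)" "real (card \<Lambda>) \<le> (\<Sum>i\<in>N. (1 + \<eta>) * a)"
    unfolding card by (intro sum_mono q l2_basis_fun finite_N; assumption)+
  then have \<rho>: "(1 - \<eta>) * a \<le> \<rho>" "\<rho> \<le> (1 + \<eta>) * a"
    using N by (simp_all add: \<rho>_def field_simps)
  \<comment> \<open>Equivalent to \<open>1 + \<eta> \<le> (1 - \<eta>) * (1 + 3 * \<eta>)\<close>,
    the comparison behind the upper bound.\<close>
  have \<eta>2: "3 * \<eta>\<^sup>2 \<le> \<eta>"
    using mult_right_mono[OF assms(6), of \<eta>] assms(4) by (simp add: power2_eq_square)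
  have "\<rho> * (1 - \<delta>) \<le> \<rho> * (1 - 3 * \<eta>)"
    using assms(5) by (intro mult_left_mono) (auto simp: \<rho>_def)
  also have "\<dots> \<le> (1 + \<eta>) * a * (1 - 3 * \<eta>)"
    using \<rho> assms(6) by (intro mult_right_mono) auto
  also have "\<dots> = ((1 - \<eta>) - \<eta> - 3 * \<eta>\<^sup>2) * a" by (simp add: power2_eq_square algebra_simps)
  also have "\<dots> \<le> (1 - \<eta>) * a"
    using a assms(4) zero_le_power2[of \<eta>] by (intro mult_right_mono) linarith+
  also have "\<dots> \<le> q x" using q assms(7) by blast
  finally show "real (card \<Lambda>) / real (card N) * (1 - \<delta>) \<le> (\<Sum>l\<in>\<Lambda>. (cmod (ip N x (u l)))\<^sup>2)"
    by (simp add: \<rho>_def q_def)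
  have "q x \<le> (1 + \<eta>) * a" using q assms(7) by blast
  also have "\<dots> \<le> ((1 + \<eta>) + (\<eta> - 3 * \<eta>\<^sup>2)) * a"
    using a \<eta>2 by (intro mult_right_mono) auto
  also have "\<dots> = (1 - \<eta>) * a * (1 + 3 * \<eta>)" by (simp add: power2_eq_square algebra_simps)
  also have "\<dots> \<le> \<rho> * (1 + 3 * \<eta>)" using \<rho> assms(4) by (intro mult_right_mono) auto
  also have "\<dots> \<le> \<rho> * (1 + \<delta>)"
    using assms(5) by (intro mult_left_mono) (auto simp: \<rho>_def)
  finally show "(\<Sum>l\<in>\<Lambda>. (cmod (ip N x (u l)))\<^sup>2) \<le> real (card \<Lambda>) / real (card N) * (1 + \<delta>)"
    by (simp add: \<rho>_def q_def)
qed

end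

section \<open>Gabor frames with Steinhaus windows\<close>

definition frame_sum ::
    "'n set \<Rightarrow> ('l \<Rightarrow> 'n \<Rightarrow> complex) \<Rightarrow> 'l set \<Rightarrow> ('n \<Rightarrow> complex) \<Rightarrow> real" where
  "frame_sum N u \<Lambda> x = (\<Sum>l\<in>\<Lambda>. (cmod (ip N x (u l)))\<^sup>2)"

lemma frame_sum_scale: "frame_sum N u \<Lambda> (\<lambda>i. of_real r * x i) = r\<^sup>2 * frame_sum N u \<Lambda> x"
  by (simp add: frame_sum_def ip_scale_left norm_mult power_mult_distrib sum_distrib_left)

text \<open>Homogeneity removes the normalisation, since a countable dense set of vectors need not
  meet the unit sphere.\<close>

lemma frame_bounds_homogeneous:
  assumes "finite N" and unit: "\<And>x. l2 N x = 1 \<Longrightarrow> a \<le> frame_sum N u \<Lambda> x \<and> frame_sum N u \<Lambda> x \<le> b"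
  shows "a * (l2 N x)\<^sup>2 \<le> frame_sum N u \<Lambda> x \<and> frame_sum N u \<Lambda> x \<le> b * (l2 N x)\<^sup>2"
proof (cases "l2 N x = 0")
  case True
  then have "\<forall>i\<in>N. x i = 0" using assms(1) by (simp add: L2_set_eq_0_iff)
  then show ?thesis using True by (simp add: frame_sum_def ip_def)
next
  case False
  define r where "r = l2 N x"
  have r: "0 < r" using False by (simp add: r_def order_less_le)
  define z where "z = (\<lambda>i. of_real (1 / r) * x i)"
  have "l2 N z = L2_set (\<lambda>i. (1 / r) * cmod (x i)) N"
    using r by (simp add: z_def norm_divide)
  also have "\<dots> = (1 / r) * l2 N x"
    using r by (intro L2_set_right_distrib[symmetric]) simp
  finally have "l2 N z = 1" using r by (simp add: r_def)
  then have "a \<le> frame_sum N u \<Lambda> z" "frame_sum N u \<Lambda> z \<le> b" using unit by auto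
  moreover have "frame_sum N u \<Lambda> z = frame_sum N u \<Lambda> x / r\<^sup>2"
    unfolding z_def frame_sum_scale by (simp add: power_divide)
  ultimately show ?thesis using r by (simp add: field_simps flip: r_def)
qed

text \<open>Reducing to countably many test vectors makes the event measurable in the window.\<close>
lemma frame_bounds_dense:
  assumes "finite N" and dense: "closure Q = (UNIV :: complex set)"
  shows "(\<forall>x. l2 N x = 1 \<longrightarrow> a \<le> frame_sum N u \<Lambda> x \<and> frame_sum N u \<Lambda> x \<le> b) \<longleftrightarrow>
    (\<forall>x\<in>PiE N (\<lambda>_. Q). a * (l2 N x)\<^sup>2 \<le> frame_sum N u \<Lambda> x \<and> frame_sum N u \<Lambda> x \<le> b * (l2 N x)\<^sup>2)"
    (is "?L \<longleftrightarrow> ?R")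
proof
  assume ?L
  then show ?R using frame_bounds_homogeneous[OF assms(1)] by blast
next
  assume R: ?R
  show ?L
  proof (intro allI impI)
    fix x :: "'a \<Rightarrow> complex" assume x: "l2 N x = 1"
    have "\<exists>w. (\<forall>n. w n \<in> Q) \<and> w \<longlonglongrightarrow> x i" for i
      using dense by (simp flip: closure_sequential)
    then obtain w where w: "\<And>i n. w i n \<in> Q" "\<And>i. w i \<longlonglongrightarrow> x i" by metis
    \<comment> \<open>The restriction makes the approximants extensional, as \<open>PiE\<close>
      demands; only values on \<open>N\<close> enter the norm and the frame sum.\<close>
    define z where "z n = restrict (\<lambda>i. w i n) N" for n
    have z: "z n \<in> PiE N (\<lambda>_. Q)" for n using w by (auto simp: z_def)
    have lim: "(\<lambda>n. z n i) \<longlonglongrightarrow> x i" if "i \<in> N" for i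
      using that w by (simp add: z_def)
    have fs: "(\<lambda>n. frame_sum N u \<Lambda> (z n)) \<longlonglongrightarrow> frame_sum N u \<Lambda> x"
      unfolding frame_sum_def ip_def by (intro tendsto_intros lim)
    have "(\<lambda>n. (l2 N (z n))\<^sup>2) \<longlonglongrightarrow> (l2 N x)\<^sup>2"
      by (simp add: L2_set_def sum_nonneg) (intro tendsto_intros lim)
    then have n: "(\<lambda>n. (l2 N (z n))\<^sup>2) \<longlonglongrightarrow> 1" by (simp add: x)
    have "a * 1 \<le> frame_sum N u \<Lambda> x"
      by (rule LIMSEQ_le[OF tendsto_mult[OF tendsto_const n] fs]) (use R z in blast)
    moreover have "frame_sum N u \<Lambda> x \<le> b * 1"
      by (rule LIMSEQ_le[OF fs tendsto_mult[OF tendsto_const n]]) (use R z in blast)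
    ultimately show "a \<le> frame_sum N u \<Lambda> x \<and> frame_sum N u \<Lambda> x \<le> b" by simp
  qed
qed

section \<open>Tightness of the full Gabor system\<close>

definition gabor_atom :: "nat \<Rightarrow> (nat \<Rightarrow> real) \<Rightarrow> nat \<times> nat \<Rightarrow> nat \<Rightarrow> complex" where
  "gabor_atom M y p = vec_index (tf_shift M p (steinhaus_window M y))"

lemma gabor_atom_eq:
  assumes "j < M"
  shows "gabor_atom M y (k, l) j = complex_of_real (1 / sqrt (real M)) *
    cis (2 * pi * real l * real j / real M + 2 * pi * y (nat ((int j - int k) mod int M)))"
proof -
  have "nat ((int j - int k) mod int M) < M" using assms by (simp add: nat_less_iff)
  then show ?thesis
    using assms by (simp add: gabor_atom_def tf_shift_def steinhaus_window_def flip: cis_mult)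
qed

text \<open>Orthogonality of characters. For \<open>i \<noteq> j\<close> the sum is geometric with
  ratio \<open>z\<close>, where \<open>z ^ M = 1\<close>, and \<open>z = 1\<close> would force
  \<open>M\<close> to divide \<open>i - j\<close>.\<close>

lemma sum_roots_of_unity:
  assumes "i < M" "j < M"
  shows "(\<Sum>l<M. cis (2 * pi * real l * real i / real M) * cnj (cis (2 * pi * real l * real j / real M))) =
    (if i = j then of_nat M else 0)"
proof -
  define z where "z = cis (2 * pi * (real i - real j) / real M)"
  have M: "0 < M" using assms by simp
  have pow: "cis (2 * pi * real l * real i / real M) * cnj (cis (2 * pi * real l * real j / real M)) = z ^ l" for l
    unfolding z_def Complex.DeMoivre cis_cnj cis_mult using M
    by (intro arg_cong[where f = cis]) (simp add: field_simps)
  show ?thesis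
  proof (cases "i = j")
    case True
    then show ?thesis unfolding pow by (simp add: z_def)
  next
    case False
    have "z \<noteq> 1"
    proof
      assume "z = 1"
      then have "cos (2 * pi * (real i - real j) / real M) = 1"
        by (simp add: z_def complex_eq_iff)
      then obtain n :: int where "2 * pi * (real i - real j) / real M = of_int n * 2 * pi"
        by (auto simp: cos_one_2pi_int)
      then have "2 * pi * (real i - real j) = 2 * pi * (of_int n * real M)"
        using M by (simp add: field_simps)
      then have "real i - real j = of_int n * real M"
        by (simp only: mult_cancel_left) simp
      then have "real_of_int (int i - int j) = real_of_int (n * int M)" by simp
      then have eq: "int i - int j = n * int M" by (simp only: of_int_eq_iff)
      then have "int M dvd int i - int j" by simp
      then have "int i mod int M = int j mod int M" by (simp add: mod_eq_dvd_iff)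
      with False assms show False by simp
    qed
    moreover have "z ^ M = 1"
    proof -
      have "z ^ M = cis (2 * pi * of_int (int i - int j))"
        using M by (simp add: z_def Complex.DeMoivre)
      then show ?thesis by (simp only: cis_multiple_2pi Ints_of_int)
    qed
    ultimately show ?thesis unfolding pow using False by (simp add: sum_gp_strict)
  qed
qed

text \<open>The sum over modulations kills the entries with \<open>i \<noteq> j\<close>. On the
  diagonal the constant modulus of the window makes each of the \<open>M\<close> translations
  contribute 1.\<close>

lemma gabor_tight_unit_frame:
  assumes "0 < M"
  shows "tight_unit_frame {..<M} ({..<M} \<times> {..<M}) (gabor_atom M y) (real M)"
proof
  fix p assume "p \<in> {..<M} \<times> {..<M}"
  then show "l2 {..<M} (gabor_atom M y p) = 1"
    using assms by (cases p) (simp add: L2_set_def gabor_atom_eq norm_mult norm_divide power_divide)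
next
  fix i j assume i: "i \<in> {..<M}" and j: "j \<in> {..<M}"
  define h where "h k i = cis (2 * pi * y (nat ((int i - int k) mod int M)))" for k i
  have sq: "complex_of_real (1 / sqrt (real M)) * complex_of_real (1 / sqrt (real M)) = 1 / of_nat M"
    using assms by (simp flip: of_real_mult)
  have atom: "gabor_atom M y (k, l) i * cnj (gabor_atom M y (k, l) j) = 1 / of_nat M * (h k i * cnj (h k j)) *
      (cis (2 * pi * real l * real i / real M) * cnj (cis (2 * pi * real l * real j / real M)))" for k l
    using i j by (simp add: gabor_atom_eq h_def flip: cis_mult sq)
  have "(\<Sum>p\<in>{..<M} \<times> {..<M}. gabor_atom M y p i * cnj (gabor_atom M y p j)) =
      (\<Sum>k<M. \<Sum>l<M. gabor_atom M y (k, l) i * cnj (gabor_atom M y (k, l) j))"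
    by (simp add: sum.cartesian_product)
  also have "\<dots> = (\<Sum>k<M. 1 / of_nat M * (h k i * cnj (h k j)) * (if i = j then of_nat M else 0))"
    unfolding atom sum_distrib_left[symmetric] using i j by (simp add: sum_roots_of_unity)
  also have "\<dots> = (if i = j then of_real (real M) else 0)"
    using assms by (simp add: h_def cis_cnj cis_mult)
  finally show "(\<Sum>p\<in>{..<M} \<times> {..<M}. gabor_atom M y p i * cnj (gabor_atom M y p j)) =
      (if i = j then of_real (real M) else 0)" .
qed auto

section \<open>Extremal singular values as bounds over unit vectors\<close>

lemma analysis_image:
  fixes y :: "nat \<Rightarrow> real"
  assumes "\<Lambda> \<subseteq> {..<M} \<times> {..<M}"
  defines "A \<equiv> analysis_mat M (steinhaus_window M y) \<Lambda>"
  shows "(\<lambda>x. (l2_norm_vec (A *\<^sub>v x))\<^sup>2) ` {x \<in> carrier_vec (dim_col A). l2_norm_vec x = 1} =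
    frame_sum {..<M} (gabor_atom M y) \<Lambda> ` {x. l2 {..<M} x = 1}"
proof -
  have dim: "dim_col A = M"
    by (simp add: A_def analysis_mat_def synthesis_mat_def mat_adjoint_def)
  have norm: "l2_norm_vec x = l2 {..<M} (vec_index x)" if "x \<in> carrier_vec M" for x
    using that by (auto simp: l2_norm_vec_def L2_set_def)
  have fs: "(l2_norm_vec (A *\<^sub>v x))\<^sup>2 = frame_sum {..<M} (gabor_atom M y) \<Lambda> (vec_index x)"
    if "x \<in> carrier_vec M" for x
  proof -
    have "x \<bullet>c tf_shift M p (steinhaus_window M y) = ip {..<M} (vec_index x) (gabor_atom M y p)" for p
      by (cases p) (simp add: scalar_prod_def ip_def gabor_atom_def tf_shift_def atLeast0LessThan)
    then show ?thesis
      unfolding A_def l2_norm_analysis_mat[OF that assms(1)] by (simp add: frame_sum_def)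
  qed
  \<comment> \<open>Norm and frame sum depend only on the values below \<open>M\<close>, so cutting
    a function down to a vector of length \<open>M\<close> loses nothing.\<close>
  have ex: "frame_sum {..<M} (gabor_atom M y) \<Lambda> x = (l2_norm_vec (A *\<^sub>v Matrix.vec M x))\<^sup>2 \<and>
      l2_norm_vec (Matrix.vec M x) = 1" if "l2 {..<M} x = 1" for x
    using that by (auto simp: fs norm frame_sum_def ip_def L2_set_def)
  show ?thesis
  proof (intro equalityI subsetI)
    fix r assume "r \<in> (\<lambda>x. (l2_norm_vec (A *\<^sub>v x))\<^sup>2) ` {x \<in> carrier_vec (dim_col A). l2_norm_vec x = 1}"
    then show "r \<in> frame_sum {..<M} (gabor_atom M y) \<Lambda> ` {x. l2 {..<M} x = 1}"
      by (auto simp: dim fs norm)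
  next
    fix r assume "r \<in> frame_sum {..<M} (gabor_atom M y) \<Lambda> ` {x. l2 {..<M} x = 1}"
    then obtain x where "l2 {..<M} x = 1" "r = frame_sum {..<M} (gabor_atom M y) \<Lambda> x" by blast
    then show "r \<in> (\<lambda>x. (l2_norm_vec (A *\<^sub>v x))\<^sup>2) ` {x \<in> carrier_vec (dim_col A). l2_norm_vec x = 1}"
      using ex[of x] dim by (intro image_eqI[of _ _ "Matrix.vec M x"]) auto
  qed
qed

text \<open>On a nonempty bounded set of reals, bounds on \<open>Inf\<close> and \<open>Sup\<close>
  amount to bounds on every element, and \<open>Inf\<close> is at most \<open>Sup\<close>.\<close>

lemma sigma_bounds_iff:
  fixes y :: "nat \<Rightarrow> real"
  assumes "0 < M" "\<Lambda> \<subseteq> {..<M} \<times> {..<M}"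
  defines "A \<equiv> analysis_mat M (steinhaus_window M y) \<Lambda>"
  shows "a \<le> sigma_min_sq A \<and> sigma_min_sq A \<le> sigma_max_sq A \<and> sigma_max_sq A \<le> b \<longleftrightarrow>
    (\<forall>x. l2 {..<M} x = 1 \<longrightarrow>
      a \<le> frame_sum {..<M} (gabor_atom M y) \<Lambda> x \<and> frame_sum {..<M} (gabor_atom M y) \<Lambda> x \<le> b)"
proof -
  interpret tight_unit_frame "{..<M}" "{..<M} \<times> {..<M}" "gabor_atom M y" "real M"
    using assms(1) by (rule gabor_tight_unit_frame)
  let ?f = "frame_sum {..<M} (gabor_atom M y) \<Lambda>"
  define V where "V = ?f ` {x. l2 {..<M} x = 1}"
  have min: "sigma_min_sq A = Inf V" and max: "sigma_max_sq A = Sup V"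
    unfolding sigma_min_sq_def sigma_max_sq_def V_def A_def
    by (simp_all only: analysis_image[OF assms(2)])
  have "l2 {..<M} (basis_fun 0) = 1" using assms(1) by (intro l2_basis_fun) auto
  then have ne: "V \<noteq> {}" by (auto simp: V_def)
  \<comment> \<open>The full tight frame dominates, so \<open>Sup\<close> is taken over a set
    bounded above.\<close>
  have "?f x \<le> real M" if "l2 {..<M} x = 1" for x
  proof -
    have "?f x \<le> (\<Sum>l\<in>{..<M} \<times> {..<M}. (cmod (ip {..<M} x (gabor_atom M y l)))\<^sup>2)"
      unfolding frame_sum_def using assms(2) by (intro sum_mono2) auto
    then show ?thesis using sum_frame_coeff[of x] that by simp
  qed
  then have above: "bdd_above V" by (auto simp: V_def intro!: bdd_aboveI2)
  have below: "bdd_below V" by (auto simp: V_def frame_sum_def intro!: bdd_belowI2 sum_nonneg)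
  have "(a \<le> Inf V \<and> Inf V \<le> Sup V \<and> Sup V \<le> b) \<longleftrightarrow> (\<forall>v\<in>V. a \<le> v \<and> v \<le> b)"
    using ne above below
    by (auto simp: le_cInf_iff cSup_le_iff intro: cInf_le_cSup)
  then show ?thesis unfolding min max by (auto simp: V_def)
qed

section \<open>Measurability in the phases\<close>

lemma prob_space_phase_measure: "prob_space (phase_measure M)"
  unfolding phase_measure_def
  by (intro prob_space_PiM prob_space_uniform_measure) auto

lemma gabor_atom_measurable [measurable]:
  assumes "j < M"
  shows "(\<lambda>y. gabor_atom M y p j) \<in> borel_measurable (phase_measure M)"
proof -
  obtain k l where p: "p = (k, l)" by (cases p)
  define j' where "j' = nat ((int j - int k) mod int M)"
  have "j' < M" using assms by (simp add: j'_def nat_less_iff)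
  then have "(\<lambda>y. y j') \<in> measurable (phase_measure M) (uniform_measure lborel {0..<1})"
    unfolding phase_measure_def by (intro measurable_component_singleton) simp
  then have [measurable]: "(\<lambda>y. y j') \<in> borel_measurable (phase_measure M)"
    by (simp add: measurable_def)
  have [measurable]: "cis \<in> borel_measurable borel"
    by (intro borel_measurable_continuous_onI continuous_on_cis continuous_on_id)
  show ?thesis
    unfolding p using assms by (subst gabor_atom_eq) (simp_all flip: j'_def)
qed

text \<open>The event of \<open>prob_frame_bounds\<close> with the extremal values unfolded into a
  condition on all unit vectors, the form in which measurability is accessible.\<close>

definition good_windows :: "nat \<Rightarrow> real \<Rightarrow> (nat \<times> nat) set \<Rightarrow> (nat \<Rightarrow> real) set" where
  "good_windows M \<delta> \<Lambda> = {y \<in> space (phase_measure M). \<forall>x. l2 {..<M} x = 1 \<longrightarrow>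
     real (card \<Lambda>) / real M * (1 - \<delta>) \<le> frame_sum {..<M} (gabor_atom M y) \<Lambda> x \<and>
     frame_sum {..<M} (gabor_atom M y) \<Lambda> x \<le> real (card \<Lambda>) / real M * (1 + \<delta>)}"

lemma prob_frame_bounds_eq:
  assumes "0 < M" "\<Lambda> \<subseteq> {..<M} \<times> {..<M}"
  shows "prob_frame_bounds M \<delta> \<Lambda> = measure (phase_measure M) (good_windows M \<delta> \<Lambda>)"
  unfolding prob_frame_bounds_def good_windows_def Let_def sigma_bounds_iff[OF assms] ..

lemma good_windows_measurable: "good_windows M \<delta> \<Lambda> \<in> sets (phase_measure M)"
proof -
  obtain Q :: "complex set" where Q: "countable Q" "\<And>X. open X \<Longrightarrow> X \<noteq> {} \<Longrightarrow> \<exists>d\<in>Q. d \<in> X"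
    by (rule countable_dense_setE) blast
  have "closure Q = UNIV"
  proof (intro equalityI subsetI)
    fix z :: complex
    have "\<exists>d\<in>Q. dist d z < e" if "e > 0" for e
      using Q(2)[of "ball z e"] that by (auto simp: dist_commute)
    then show "z \<in> closure Q" by (simp add: closure_approachable)
  qed simp
  note dense = frame_bounds_dense[OF finite_lessThan this]
  have [measurable]: "(\<lambda>y. frame_sum {..<M} (gabor_atom M y) \<Lambda> x) \<in> borel_measurable (phase_measure M)" for x
  proof -
    have [measurable]: "cnj \<in> borel_measurable borel"
      by (intro borel_measurable_continuous_onI continuous_on_cnj continuous_on_id)
    show ?thesis unfolding frame_sum_def ip_def by measurable
  qed
  have "countable (PiE {..<M} (\<lambda>_. Q))" using Q(1) by (intro countable_PiE) auto
  then show ?thesis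
    unfolding good_windows_def dense by measurable
qed

text \<open>Turns a bound over index sets for each window into one over windows for most index sets:
  the mean of \<open>measure W (B b)\<close> is at most \<open>\<kappa>\<close>, and Markov's
  inequality applies. As \<open>P\<close> has finite support, Fubini amounts to exchanging a finite
  sum with an integral.\<close>

lemma fubini_markov:
  assumes P: "finite (set_pmf P)" and "prob_space W" and "0 < \<epsilon>"
    and meas: "\<And>b. b \<in> set_pmf P \<Longrightarrow> B b \<in> sets W"
    and small: "\<And>y. y \<in> space W \<Longrightarrow> measure_pmf.prob P {b. y \<in> B b} \<le> \<kappa>"
  shows "measure_pmf.prob P {b. \<epsilon> < measure W (B b)} \<le> \<kappa> / \<epsilon>"
proof -
  interpret W: prob_space W by fact
  have int: "integrable (measure_pmf P) f" for f :: "_ \<Rightarrow> real"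
    using P by (rule integrable_measure_pmf_finite)
  have Wint: "integrable W (\<lambda>y. pmf P b * indicat_real (B b) y)" if "b \<in> set_pmf P" for b
    using meas[OF that] by (intro integrable_mult_right) (simp add: W.emeasure_finite less_top[symmetric])
  have "measure_pmf.prob P {b. \<epsilon> < measure W (B b)} \<le>
      measure_pmf.prob P {b \<in> space (measure_pmf P). \<epsilon> \<le> measure W (B b)}"
    by (intro measure_pmf.finite_measure_mono) auto
  also have "\<dots> \<le> measure_pmf.expectation P (\<lambda>b. measure W (B b)) / \<epsilon>"
    using \<open>0 < \<epsilon>\<close> by (intro integral_Markov_inequality_measure[OF int, where A = UNIV]) auto
  also have "measure_pmf.expectation P (\<lambda>b. measure W (B b)) =
      (\<Sum>b\<in>set_pmf P. pmf P b * measure W (B b))"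
    using P by (subst integral_measure_pmf) auto
  also have "\<dots> = (\<Sum>b\<in>set_pmf P. \<integral>y. pmf P b * indicat_real (B b) y \<partial>W)"
    using meas by (intro sum.cong) auto
  also have "\<dots> = (\<integral>y. (\<Sum>b\<in>set_pmf P. pmf P b * indicat_real (B b) y) \<partial>W)"
    by (rule Bochner_Integration.integral_sum[symmetric]) (rule Wint)
  also have "\<dots> \<le> (\<integral>y. \<kappa> \<partial>W)"
  proof (rule integral_mono)
    show "integrable W (\<lambda>y. \<Sum>b\<in>set_pmf P. pmf P b * indicat_real (B b) y)"
      by (intro Bochner_Integration.integrable_sum Wint)
    fix y assume y: "y \<in> space W"
    have "(\<Sum>b\<in>set_pmf P. pmf P b * indicat_real (B b) y) = measure_pmf.expectation P (indicat_real {b. y \<in> B b})"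
      using P by (subst integral_measure_pmf) (auto simp: indicator_def)
    also have "\<dots> \<le> \<kappa>" using small[OF y] by simp
    finally show "(\<Sum>b\<in>set_pmf P. pmf P b * indicat_real (B b) y) \<le> \<kappa>" .
  qed simp
  also have "\<dots> = \<kappa>" by (simp add: W.prob_space)
  finally show ?thesis using \<open>0 < \<epsilon>\<close> by (simp add: divide_right_mono)
qed

text \<open>For a fixed window, failure of the frame bounds implies an excessive trace, which has
  small probability over the index sets; \<open>fubini_markov\<close> then exchanges the roles of
  the two.\<close>

lemma prob_bad_index_set:
  assumes "0 < M" "0 < s" "0 \<le> t" "t \<le> 1" "1 \<le> t * real M"
    and \<eta>: "0 < \<eta>" "3 * \<eta> \<le> \<delta>" "3 * \<eta> \<le> 1" and "0 < \<epsilon>"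
  shows "1 - moment_const s * real M / (\<eta> ^ (2 * s) * (t * real M) ^ s) / \<epsilon> \<le>
    measure_pmf.prob (random_index_set M t) {\<Lambda>. 1 - \<epsilon> \<le> prob_frame_bounds M \<delta> \<Lambda>}"
proof -
  let ?A = "{..<M} \<times> {..<M}"
  define P where "P = Pi_pmf ?A False (\<lambda>_. bernoulli_pmf t)"
  define W where "W = phase_measure M"
  interpret W: prob_space W unfolding W_def by (rule prob_space_phase_measure)
  define B where "B b = space W - good_windows M \<delta> {p. b p}" for b
  have sub: "{p. b p} \<subseteq> ?A" if "b \<in> set_pmf P" for b
    using that set_Pi_pmf_subset[of ?A False "\<lambda>_. bernoulli_pmf t"] by (auto simp: P_def)
  have fin: "finite (set_pmf P)" unfolding P_def by (intro finite_set_Pi_pmf) auto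
  have "measure_pmf.prob P {b. \<epsilon> < measure W (B b)} \<le>
      moment_const s * real M / (\<eta> ^ (2 * s) * (t * real M) ^ s) / \<epsilon>"
  proof (rule fubini_markov[OF fin W.prob_space_axioms \<open>0 < \<epsilon>\<close>])
    show "B b \<in> sets W" for b
      using good_windows_measurable by (auto simp: B_def W_def)
    fix y assume y: "y \<in> space W"
    interpret tight_unit_frame "{..<M}" ?A "gabor_atom M y" "real M"
      using assms(1) by (rule gabor_tight_unit_frame)
    \<comment> \<open>Only patterns in the support are known to give subsets of the index grid, so
      the event is first cut down to the support.\<close>
    have "measure_pmf.prob P {b. y \<in> B b} = measure_pmf.prob P ({b. y \<in> B b} \<inter> set_pmf P)"
      by (simp add: measure_Int_set_pmf)
    also have "\<dots> \<le> measure_pmf.prob P {b. (\<eta> * (t * real M)) ^ (2 * s) <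
        Re (power_trace {..<M} ?A (gabor_atom M y) (centered t b) (2 * s))}"
    proof (intro measure_pmf.finite_measure_mono subsetI, simp_all, elim conjE, rule ccontr)
      fix b assume b: "y \<in> B b" "b \<in> set_pmf P"
        and "\<not> (\<eta> * (t * real M)) ^ (2 * s) <
          Re (power_trace {..<M} ?A (gabor_atom M y) (centered t b) (2 * s))"
      then have "Re (power_trace {..<M} ?A (gabor_atom M y) (centered t (\<lambda>p. p \<in> {p. b p})) (2 * s)) \<le>
          (\<eta> * (t * real M)) ^ (2 * s)" by simp
      then have "y \<in> good_windows M \<delta> {p. b p}"
        using frame_bounds_relative[OF sub[OF b(2)] assms(2) _ \<eta>, of t] y assms(5)
        by (simp add: good_windows_def W_def frame_sum_def)
      with b(1) show False by (simp add: B_def)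
    qed
    also have "\<dots> \<le> moment_const s * real M / (\<eta> ^ (2 * s) * (t * real M) ^ s)"
      using prob_trace_gt_le[OF assms(3,4,5) \<eta>(1), of s] by (simp add: P_def)
    finally show "measure_pmf.prob P {b. y \<in> B b} \<le>
      moment_const s * real M / (\<eta> ^ (2 * s) * (t * real M) ^ s)" .
  qed
  moreover have "1 - measure_pmf.prob P {b. \<epsilon> < measure W (B b)} =
      measure_pmf.prob P (- {b. \<epsilon> < measure W (B b)})"
    using measure_pmf.prob_compl[of "{b. \<epsilon> < measure W (B b)}" P] by (simp add: Compl_eq_Diff_UNIV)
  moreover have "measure_pmf.prob P (- {b. \<epsilon> < measure W (B b)}) \<le>
      measure_pmf.prob (random_index_set M t) {\<Lambda>. 1 - \<epsilon> \<le> prob_frame_bounds M \<delta> \<Lambda>}"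
  proof -
    have "measure_pmf.prob P (- {b. \<epsilon> < measure W (B b)}) =
        measure_pmf.prob P (- {b. \<epsilon> < measure W (B b)} \<inter> set_pmf P)"
      by (simp add: measure_Int_set_pmf)
    also have "\<dots> \<le> measure_pmf.prob P {b. 1 - \<epsilon> \<le> prob_frame_bounds M \<delta> {p. b p}}"
    proof (intro measure_pmf.finite_measure_mono subsetI CollectI)
      fix b assume b: "b \<in> - {b. \<epsilon> < measure W (B b)} \<inter> set_pmf P"
      have "measure W (B b) = 1 - measure W (good_windows M \<delta> {p. b p})"
        unfolding B_def by (rule W.prob_compl) (simp add: W_def good_windows_measurable)
      with b show "1 - \<epsilon> \<le> prob_frame_bounds M \<delta> {p. b p}"
        using sub[of b] by (simp add: prob_frame_bounds_eq[OF assms(1)] W_def)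
    qed simp
    also have "\<dots> = measure_pmf.prob (random_index_set M t) {\<Lambda>. 1 - \<epsilon> \<le> prob_frame_bounds M \<delta> \<Lambda>}"
      by (simp add: random_index_set_def P_def vimage_def)
    finally show ?thesis .
  qed
  ultimately show ?thesis by linarith
qed

section \<open>Choice of parameters and the limit in \<open>M\<close>\<close>

lemma tau_bound_power:
  assumes "0 < m" "1 < M"
  shows "(tau m C M * real M) ^ m = (C * ln (real M)) ^ m * real M"
proof -
  have "real M / real M powr ((real m - 1) / real m) = real M powr (1 - (real m - 1) / real m)"
    using assms by (simp add: powr_diff)
  also have "1 - (real m - 1) / real m = 1 / real m"
    using assms by (simp add: field_simps)
  finally have "C * ln (real M) * (real M / real M powr ((real m - 1) / real m)) =
      C * ln (real M) * real M powr (1 / real m)"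
    by (rule arg_cong)
  then have "tau m C M * real M = C * ln (real M) * real M powr (1 / real m)"
    by (simp add: tau_def)
  \<comment> \<open>The \<open>m\<close>-th power recovers a full factor \<open>M\<close>, which
    later cancels the dimension in the Markov bound.\<close>
  moreover have "(real M powr (1 / real m)) ^ m = real M"
    using assms by (simp add: powr_powr flip: powr_realpow)
  ultimately show ?thesis by (simp add: power_mult_distrib)
qed

theorem theorem2p3:
  fixes m :: nat
  assumes "even m" and "m > 0"
  shows "\<exists>C0>0. \<forall>C\<ge>C0. \<forall>\<delta>>0. \<exists>\<epsilon>::real. 0 < \<epsilon> \<and> \<epsilon> < 1 \<and>
    (\<lambda>M. measure_pmf.prob (random_index_set M (tau m C M))
            {\<Lambda>. prob_frame_bounds M \<delta> \<Lambda> \<ge> 1 - \<epsilon>}) \<longlonglongrightarrow> 1"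
proof (rule exI[of _ 1], intro conjI allI impI)
  fix C \<delta> :: real assume C: "1 \<le> C" and \<delta>: "0 < \<delta>"
  have m: "2 \<le> m" using assms by (auto elim!: evenE)
  \<comment> \<open>The largest value meeting both smallness conditions of
    \<open>frame_bounds_relative\<close>.\<close>
  define \<eta> where "\<eta> = min \<delta> 1 / 3"
  have \<eta>: "0 < \<eta>" "3 * \<eta> \<le> \<delta>" "3 * \<eta> \<le> 1" using \<delta> by (auto simp: \<eta>_def)
  \<comment> \<open>Collects everything independent of \<open>M\<close>. The factor
    \<open>1/2\<close> is the chosen \<open>\<epsilon>\<close>; the bound tends to zero for each
    fixed positive value.\<close>
  define K where "K = moment_const m / \<eta> ^ (2 * m) / (1/2)"
  define r where "r = (real m - 1) / real m"
  have r: "0 < r" using m by (simp add: r_def)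
  \<comment> \<open>The exponent is positive because \<open>m \<ge> 2\<close>, so \<open>tau\<close>
    eventually drops below 1 and is a genuine Bernoulli parameter.\<close>
  have "(\<lambda>M. C * ln (real M) / real M powr r) \<longlonglongrightarrow> 0"
    using r by real_asymp
  then have "(\<lambda>M. tau m C M) \<longlonglongrightarrow> 0" by (simp add: tau_def r_def)
  then have "\<forall>\<^sub>F M in sequentially. tau m C M < 1"
    by (rule order_tendstoD) simp
  moreover have "\<forall>\<^sub>F M in sequentially. 1 \<le> ln (real M)"
    by real_asymp
  ultimately have ev: "\<forall>\<^sub>F M in sequentially. 1 - K / (C * ln (real M)) ^ m \<le>
      measure_pmf.prob (random_index_set M (tau m C M)) {\<Lambda>. 1 - 1/2 \<le> prob_frame_bounds M \<delta> \<Lambda>}"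
    using eventually_gt_at_top[of 1]
  proof eventually_elim
    case (elim M)
    have M: "0 < M" "1 < M" using elim by auto
    \<comment> \<open>The witness 1 for \<open>C0\<close> enters here; it secures
      \<open>1 \<le> tau m C M * real M\<close>, as the trace bound requires.\<close>
    have "1 \<le> C * ln (real M)" using C elim by (simp add: mult_ge1_I)
    then have p: "1 \<le> (C * ln (real M)) ^ m" by (rule one_le_power)
    have pow: "(tau m C M * real M) ^ m = (C * ln (real M)) ^ m * real M"
      using tau_bound_power assms(2) M(2) by blast
    have nonneg: "0 \<le> tau m C M" using C M by (simp add: tau_def)
    have "1 \<le> (tau m C M * real M) ^ m"
      unfolding pow using mult_mono[OF p, of 1 "real M"] p M by simp
    then have "1 \<le> tau m C M * real M"
      using nonneg assms(2) by (metis M(1) mult_nonneg_nonneg not_le of_nat_0_le_iff power_less_one_iff)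
    then have "1 - moment_const m * real M / (\<eta> ^ (2 * m) * (tau m C M * real M) ^ m) / (1/2) \<le>
        measure_pmf.prob (random_index_set M (tau m C M)) {\<Lambda>. 1 - 1/2 \<le> prob_frame_bounds M \<delta> \<Lambda>}"
      using elim by (intro prob_bad_index_set M(1) assms(2) nonneg \<eta>) auto
    moreover have "moment_const m * real M / (\<eta> ^ (2 * m) * (tau m C M * real M) ^ m) / (1/2) =
        K / (C * ln (real M)) ^ m"
      unfolding pow K_def using M by simp
    ultimately show ?case by simp
  qed
  have "(\<lambda>M. 1 - K / (C * ln (real M)) ^ m) \<longlonglongrightarrow> 1 - 0"
  proof (intro tendsto_diff tendsto_const tendsto_divide_0[OF tendsto_const])
    have "filterlim (\<lambda>M. C * ln (real M)) at_top sequentially"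
      using C by real_asymp
    then have "filterlim (\<lambda>M. (C * ln (real M)) ^ m) at_top sequentially"
      using assms(2) by (intro filterlim_pow_at_top)
    then show "filterlim (\<lambda>M. (C * ln (real M)) ^ m) at_infinity sequentially"
      by (rule filterlim_at_top_imp_at_infinity)
  qed
  then have lower: "(\<lambda>M. 1 - K / (C * ln (real M)) ^ m) \<longlonglongrightarrow> 1" by simp
  have "(\<lambda>M. measure_pmf.prob (random_index_set M (tau m C M))
      {\<Lambda>. 1 - 1/2 \<le> prob_frame_bounds M \<delta> \<Lambda>}) \<longlonglongrightarrow> 1"
    by (rule tendsto_sandwich[OF ev _ lower tendsto_const]) (simp add: always_eventually)
  then show "\<exists>\<epsilon>::real. 0 < \<epsilon> \<and> \<epsilon> < 1 \<and>
    (\<lambda>M. measure_pmf.prob (random_index_set M (tau m C M))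
            {\<Lambda>. prob_frame_bounds M \<delta> \<Lambda> \<ge> 1 - \<epsilon>}) \<longlonglongrightarrow> 1"
    by (intro exI[of _ "1/2"]) simp
qed simp

end
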